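(* Let $F\dashv G:\mathcal{D}\to\mathcal{C}$ be an adjunction with unit $\eta$ and counit $\epsilon$. (1) If the monad $(GF,G\epsilon F,\eta)$ is separable, then the comparison functor $K_{GF}:\mathcal{D}\to\mathcal{C}_{GF}$ is a coreflection up to retracts. (2) If the comonad $(FG,F\eta G,\epsilon)$ is coseparable, then the cocomparison functor $K^{FG}:\mathcal{C}\to\mathcal{D}^{FG}$ is a reflection up to retracts.
   Context: Here $F:\mathcal{C}\to\mathcal{D}$ is left adjoint to $G:\mathcal{D}\to\mathcal{C}$. $\mathcal{C}_{GF}$ is the Eilenberg–Moore category of modules (algebras) over the monad $(GF,G\epsilon F,\eta)$ on $\mathcal{C}$, and $\mathcal{D}^{FG}$ is the Eilenberg–Moore category of comodules (coalgebras) over the comonad $(FG,F\eta G,\epsilon)$ on $\mathcal{D}$. The comparison functor is $K_{GF}:\mathcal{D}\to\mathcal{C}_{GF}$, $D\mapsto(GD,G\epsilon_D)$, $f\mapsto G(f)$; the cocomparison functor is $K^{FG}:\mathcal{C}\to\mathcal{D}^{FG}$, $C\mapsto(FC,F\eta_C)$, $f\mapsto F(f)$. A monad $(\top,m,\eta)$ is separable if there is a natural transformation $\sigma:\top\to\top\top$ with $m\circ\sigma=\mathrm{Id}_\top$ and $\top m\circ\sigma\top=\sigma\circ m=m\top\circ\top\sigma$. A comonad $(\bot,\Delta,\epsilon)$ is coseparable if there is a natural transformation $\tau:\bot\bot\to\bot$ with $\tau\circ\Delta=\mathrm{Id}_\bot$ and $\bot\tau\circ\Delta\bot=\Delta\circ\tau=\tau\bot\circ\bot\Delta$.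 The idempotent completion $\mathcal{C}^\natural$ of a category $\mathcal{C}$ has as objects the pairs $(X,e)$ with $X$ an object of $\mathcal{C}$ and $e:X\to X$ idempotent; a morphism $f:(X,e)\to(X',e')$ is a morphism $f:X\to X'$ in $\mathcal{C}$ with $f=e'\circ f\circ e$; composition is that of $\mathcal{C}$ and $\mathrm{Id}_{(X,e)}=e$. A functor $T:\mathcal{A}\to\mathcal{B}$ induces its completion $T^\natural:\mathcal{A}^\natural\to\mathcal{B}^\natural$, $T^\natural(X,e)=(TX,Te)$, $T^\natural(f)=T(f)$. A reflection (resp. coreflection) is a functor admitting a fully faithful right (resp. left) adjoint. A functor $T$ is a reflection (resp. coreflection) up to retracts if $T^\natural$ is a reflection (resp. coreflection). *)

theory Defs
  imports Main
begin

section \<open>Categories, functors, natural transformations\<close>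

text \<open>
  A category has a carrier of objects and a carrier of arrows; every arrow determines its domain
  and codomain. Values of the operations outside the carriers are irrelevant throughout, so
  equalities of functors and of natural transformations are always stated on the carriers only.
\<close>

record ('o, 'm) cat =
  Ob :: "'o set"
  Ar :: "'m set"
  Dom :: "'m \<Rightarrow> 'o"
  Cod :: "'m \<Rightarrow> 'o"
  Ide :: "'o \<Rightarrow> 'm"
  Cmp :: "'m \<Rightarrow> 'm \<Rightarrow> 'm" (infixr "\<cdot>\<index>" 70)

definition Hom :: "('o, 'm) cat \<Rightarrow> 'o \<Rightarrow> 'o \<Rightarrow> 'm set" where
  "Hom C X Y = {f \<in> Ar C. Dom C f = X \<and> Cod C f = Y}"

locale category =
  fixes C :: "('o, 'm) cat" (structure)
  assumes Dom_Ob: "f \<in> Ar C \<Longrightarrow> Dom C f \<in> Ob C"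
    and Cod_Ob: "f \<in> Ar C \<Longrightarrow> Cod C f \<in> Ob C"
    and Ide_Hom: "X \<in> Ob C \<Longrightarrow> Ide C X \<in> Hom C X X"
    and Cmp_Hom: "\<lbrakk>f \<in> Hom C X Y; g \<in> Hom C Y Z\<rbrakk> \<Longrightarrow> g \<cdot> f \<in> Hom C X Z"
    and Cmp_Ide: "f \<in> Hom C X Y \<Longrightarrow> f \<cdot> Ide C X = f"
    and Ide_Cmp: "f \<in> Hom C X Y \<Longrightarrow> Ide C Y \<cdot> f = f"
    and Cmp_assoc:
      "\<lbrakk>f \<in> Hom C X Y; g \<in> Hom C Y Z; h \<in> Hom C Z W\<rbrakk> \<Longrightarrow> h \<cdot> (g \<cdot> f) = (h \<cdot> g) \<cdot> f"

record ('o, 'm, 'p, 'n) funct =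
  fob :: "'o \<Rightarrow> 'p"
  far :: "'m \<Rightarrow> 'n"

locale cat_functor = A: category A + B: category B
  for A :: "('o, 'm) cat" and B :: "('p, 'n) cat" +
  fixes T :: "('o, 'm, 'p, 'n) funct"
  assumes far_Hom: "f \<in> Hom A X Y \<Longrightarrow> far T f \<in> Hom B (fob T X) (fob T Y)"
    and fob_Ob: "X \<in> Ob A \<Longrightarrow> fob T X \<in> Ob B"
    and far_Ide: "X \<in> Ob A \<Longrightarrow> far T (Ide A X) = Ide B (fob T X)"
    and far_Cmp:
      "\<lbrakk>f \<in> Hom A X Y; g \<in> Hom A Y Z\<rbrakk> \<Longrightarrow> far T (g \<cdot>\<^bsub>A\<^esub> f) = far T g \<cdot>\<^bsub>B\<^esub> far T f"

definition idfun :: "('o, 'm, 'o, 'm) funct" where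
  "idfun = \<lparr>fob = (\<lambda>X. X), far = (\<lambda>f. f)\<rparr>"

definition fcomp ::
  "('p, 'n, 'q, 'r) funct \<Rightarrow> ('o, 'm, 'p, 'n) funct \<Rightarrow> ('o, 'm, 'q, 'r) funct"
  (infixr "\<circ>\<^sub>F" 55) where
  "S \<circ>\<^sub>F T = \<lparr>fob = (\<lambda>X. fob S (fob T X)), far = (\<lambda>f. far S (far T f))\<rparr>"

locale nat_trans = S: cat_functor A B S + T: cat_functor A B T
  for A :: "('o, 'm) cat" and B :: "('p, 'n) cat"
    and S T :: "('o, 'm, 'p, 'n) funct" +
  fixes \<alpha> :: "'o \<Rightarrow> 'n"
  assumes component: "X \<in> Ob A \<Longrightarrow> \<alpha> X \<in> Hom B (fob S X) (fob T X)"
    and naturality: "f \<in> Hom A X Y \<Longrightarrow> \<alpha> Y \<cdot>\<^bsub>B\<^esub> far S f = far T f \<cdot>\<^bsub>B\<^esub> \<alpha> X"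

definition fully_faithful ::
  "('o, 'm) cat \<Rightarrow> ('p, 'n) cat \<Rightarrow> ('o, 'm, 'p, 'n) funct \<Rightarrow> bool" where
  "fully_faithful A B T \<longleftrightarrow> cat_functor A B T \<and>
     (\<forall>X \<in> Ob A. \<forall>Y \<in> Ob A. bij_betw (far T) (Hom A X Y) (Hom B (fob T X) (fob T Y)))"

section \<open>Adjunctions, reflections, coreflections\<close>

text \<open>\<open>F : C \<rightarrow> D\<close> is left adjoint to \<open>G : D \<rightarrow> C\<close>, with unit \<open>\<eta>\<close> and counit \<open>\<epsilon>\<close>.\<close>

locale adjunction =
  C: category C + D: category D + F: cat_functor C D F + G: cat_functor D C G +
  unit: nat_trans C C idfun "G \<circ>\<^sub>F F" \<eta> + counit: nat_trans D D "F \<circ>\<^sub>F G" idfun \<epsilon>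
  for C :: "('o, 'm) cat" and D :: "('p, 'n) cat"
    and F :: "('o, 'm, 'p, 'n) funct" and G :: "('p, 'n, 'o, 'm) funct"
    and \<eta> :: "'o \<Rightarrow> 'm" and \<epsilon> :: "'p \<Rightarrow> 'n" +
  assumes triangle_F: "X \<in> Ob C \<Longrightarrow> \<epsilon> (fob F X) \<cdot>\<^bsub>D\<^esub> far F (\<eta> X) = Ide D (fob F X)"
    and triangle_G: "Y \<in> Ob D \<Longrightarrow> far G (\<epsilon> Y) \<cdot>\<^bsub>C\<^esub> \<eta> (fob G Y) = Ide C (fob G Y)"

definition reflection ::
  "('o, 'm) cat \<Rightarrow> ('p, 'n) cat \<Rightarrow> ('o, 'm, 'p, 'n) funct \<Rightarrow> bool" where
  "reflection A B T \<longleftrightarrow> (\<exists>R \<eta> \<epsilon>. adjunction A B T R \<eta> \<epsilon> \<and> fully_faithful B A R)"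

definition coreflection ::
  "('o, 'm) cat \<Rightarrow> ('p, 'n) cat \<Rightarrow> ('o, 'm, 'p, 'n) funct \<Rightarrow> bool" where
  "coreflection A B T \<longleftrightarrow> (\<exists>L \<eta> \<epsilon>. adjunction B A L T \<eta> \<epsilon> \<and> fully_faithful B A L)"

section \<open>Idempotent completion\<close>

text \<open>
  One arrow \<open>f\<close> of the base category may underlie arrows between several pairs of objects of a
  derived category. Its arrows are therefore triples (domain, underlying arrow, codomain); the
  same encoding is used for modules and comodules below.
\<close>

type_synonym ('x, 'm) tri = "'x \<times> 'm \<times> 'x"

definition tri_cmp :: "('o, 'm) cat \<Rightarrow> ('x, 'm) tri \<Rightarrow> ('x, 'm) tri \<Rightarrow> ('x, 'm) tri" where
  "tri_cmp C = (\<lambda>(P', g, Q') (P, f, Q). (P, g \<cdot>\<^bsub>C\<^esub> f, Q'))"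

definition idem_compl :: "('o, 'm) cat \<Rightarrow> ('o \<times> 'm, ('o \<times> 'm, 'm) tri) cat" where
  "idem_compl C = (let objs = {(X, e). X \<in> Ob C \<and> e \<in> Hom C X X \<and> e \<cdot>\<^bsub>C\<^esub> e = e} in
     \<lparr>Ob = objs,
      Ar = {((X, e), f, (X', e')). (X, e) \<in> objs \<and> (X', e') \<in> objs \<and>
              f \<in> Hom C X X' \<and> f = e' \<cdot>\<^bsub>C\<^esub> (f \<cdot>\<^bsub>C\<^esub> e)},
      Dom = (\<lambda>(P, f, Q). P),
      Cod = (\<lambda>(P, f, Q). Q),
      Ide = (\<lambda>(X, e). ((X, e), e, (X, e))),
      Cmp = tri_cmp C\<rparr>)"

definition idem_compl_functor ::
  "('o, 'm, 'p, 'n) funct \<Rightarrow>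
   ('o \<times> 'm, ('o \<times> 'm, 'm) tri, 'p \<times> 'n, ('p \<times> 'n, 'n) tri) funct" where
  "idem_compl_functor T =
     \<lparr>fob = (\<lambda>(X, e). (fob T X, far T e)),
      far = (\<lambda>((X, e), f, (X', e')). ((fob T X, far T e), far T f, (fob T X', far T e')))\<rparr>"

definition reflection_up_to_retracts ::
  "('o, 'm) cat \<Rightarrow> ('p, 'n) cat \<Rightarrow> ('o, 'm, 'p, 'n) funct \<Rightarrow> bool" where
  "reflection_up_to_retracts A B T \<longleftrightarrow>
     reflection (idem_compl A) (idem_compl B) (idem_compl_functor T)"

definition coreflection_up_to_retracts ::
  "('o, 'm) cat \<Rightarrow> ('p, 'n) cat \<Rightarrow> ('o, 'm, 'p, 'n) funct \<Rightarrow> bool" where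
  "coreflection_up_to_retracts A B T \<longleftrightarrow>
     coreflection (idem_compl A) (idem_compl B) (idem_compl_functor T)"

section \<open>Monads, modules, separability\<close>

text \<open>
  Whiskering is written out on components: \<open>(T\<mu>)\<^sub>X = T(\<mu>\<^sub>X)\<close> and \<open>(\<mu>T)\<^sub>X = \<mu>\<^bsub>TX\<^esub>\<close>.
\<close>

locale monad =
  mult: nat_trans C C "T \<circ>\<^sub>F T" T \<mu> + unit: nat_trans C C idfun T \<eta>
  for C :: "('o, 'm) cat" (structure)
    and T :: "('o, 'm, 'o, 'm) funct" and \<mu> \<eta> :: "'o \<Rightarrow> 'm" +
  assumes mult_assoc: "X \<in> Ob C \<Longrightarrow> \<mu> X \<cdot> far T (\<mu> X) = \<mu> X \<cdot> \<mu> (fob T X)"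
    and mult_unit_left: "X \<in> Ob C \<Longrightarrow> \<mu> X \<cdot> \<eta> (fob T X) = Ide C (fob T X)"
    and mult_unit_right: "X \<in> Ob C \<Longrightarrow> \<mu> X \<cdot> far T (\<eta> X) = Ide C (fob T X)"

definition separable_monad ::
  "('o, 'm) cat \<Rightarrow> ('o, 'm, 'o, 'm) funct \<Rightarrow> ('o \<Rightarrow> 'm) \<Rightarrow> ('o \<Rightarrow> 'm) \<Rightarrow> bool" where
  "separable_monad C T \<mu> \<eta> \<longleftrightarrow> monad C T \<mu> \<eta> \<and>
     (\<exists>\<sigma>. nat_trans C C T (T \<circ>\<^sub>F T) \<sigma> \<and>
       (\<forall>X \<in> Ob C.
          \<mu> X \<cdot>\<^bsub>C\<^esub> \<sigma> X = Ide C (fob T X) \<and>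
          far T (\<mu> X) \<cdot>\<^bsub>C\<^esub> \<sigma> (fob T X) = \<sigma> X \<cdot>\<^bsub>C\<^esub> \<mu> X \<and>
          \<sigma> X \<cdot>\<^bsub>C\<^esub> \<mu> X = \<mu> (fob T X) \<cdot>\<^bsub>C\<^esub> far T (\<sigma> X)))"

definition em_modules ::
  "('o, 'm) cat \<Rightarrow> ('o, 'm, 'o, 'm) funct \<Rightarrow> ('o \<Rightarrow> 'm) \<Rightarrow> ('o \<Rightarrow> 'm) \<Rightarrow>
   ('o \<times> 'm, ('o \<times> 'm, 'm) tri) cat" where
  "em_modules C T \<mu> \<eta> = (let objs = {(X, h). X \<in> Ob C \<and> h \<in> Hom C (fob T X) X \<and>
                              h \<cdot>\<^bsub>C\<^esub> \<mu> X = h \<cdot>\<^bsub>C\<^esub> far T h \<and> h \<cdot>\<^bsub>C\<^esub> \<eta> X = Ide C X} in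
     \<lparr>Ob = objs,
      Ar = {((X, h), f, (X', h')). (X, h) \<in> objs \<and> (X', h') \<in> objs \<and>
              f \<in> Hom C X X' \<and> f \<cdot>\<^bsub>C\<^esub> h = h' \<cdot>\<^bsub>C\<^esub> far T f},
      Dom = (\<lambda>(P, f, Q). P),
      Cod = (\<lambda>(P, f, Q). Q),
      Ide = (\<lambda>(X, h). ((X, h), Ide C X, (X, h))),
      Cmp = tri_cmp C\<rparr>)"

definition comparison_functor ::
  "('p, 'n) cat \<Rightarrow> ('p, 'n, 'o, 'm) funct \<Rightarrow> ('p \<Rightarrow> 'n) \<Rightarrow>
   ('p, 'n, 'o \<times> 'm, ('o \<times> 'm, 'm) tri) funct" where
  "comparison_functor D G \<epsilon> = (let K = (\<lambda>Y. (fob G Y, far G (\<epsilon> Y))) in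
     \<lparr>fob = K, far = (\<lambda>f. (K (Dom D f), far G f, K (Cod D f)))\<rparr>)"

section \<open>Comonads, comodules, coseparability\<close>

locale comonad =
  comult: nat_trans D D W "W \<circ>\<^sub>F W" \<Delta> + counit: nat_trans D D W idfun \<epsilon>
  for D :: "('p, 'n) cat" (structure)
    and W :: "('p, 'n, 'p, 'n) funct" and \<Delta> \<epsilon> :: "'p \<Rightarrow> 'n" +
  assumes comult_coassoc: "Y \<in> Ob D \<Longrightarrow> far W (\<Delta> Y) \<cdot> \<Delta> Y = \<Delta> (fob W Y) \<cdot> \<Delta> Y"
    and comult_counit_left: "Y \<in> Ob D \<Longrightarrow> \<epsilon> (fob W Y) \<cdot> \<Delta> Y = Ide D (fob W Y)"
    and comult_counit_right: "Y \<in> Ob D \<Longrightarrow> far W (\<epsilon> Y) \<cdot> \<Delta> Y = Ide D (fob W Y)"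

definition coseparable_comonad ::
  "('p, 'n) cat \<Rightarrow> ('p, 'n, 'p, 'n) funct \<Rightarrow> ('p \<Rightarrow> 'n) \<Rightarrow> ('p \<Rightarrow> 'n) \<Rightarrow> bool" where
  "coseparable_comonad D W \<Delta> \<epsilon> \<longleftrightarrow> comonad D W \<Delta> \<epsilon> \<and>
     (\<exists>\<tau>. nat_trans D D (W \<circ>\<^sub>F W) W \<tau> \<and>
       (\<forall>Y \<in> Ob D.
          \<tau> Y \<cdot>\<^bsub>D\<^esub> \<Delta> Y = Ide D (fob W Y) \<and>
          far W (\<tau> Y) \<cdot>\<^bsub>D\<^esub> \<Delta> (fob W Y) = \<Delta> Y \<cdot>\<^bsub>D\<^esub> \<tau> Y \<and>
          \<Delta> Y \<cdot>\<^bsub>D\<^esub> \<tau> Y = \<tau> (fob W Y) \<cdot>\<^bsub>D\<^esub> far W (\<Delta> Y)))"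

definition em_comodules ::
  "('p, 'n) cat \<Rightarrow> ('p, 'n, 'p, 'n) funct \<Rightarrow> ('p \<Rightarrow> 'n) \<Rightarrow> ('p \<Rightarrow> 'n) \<Rightarrow>
   ('p \<times> 'n, ('p \<times> 'n, 'n) tri) cat" where
  "em_comodules D W \<Delta> \<epsilon> = (let objs = {(Y, r). Y \<in> Ob D \<and> r \<in> Hom D Y (fob W Y) \<and>
                              \<Delta> Y \<cdot>\<^bsub>D\<^esub> r = far W r \<cdot>\<^bsub>D\<^esub> r \<and> \<epsilon> Y \<cdot>\<^bsub>D\<^esub> r = Ide D Y} in
     \<lparr>Ob = objs,
      Ar = {((Y, r), f, (Y', r')). (Y, r) \<in> objs \<and> (Y', r') \<in> objs \<and>
              f \<in> Hom D Y Y' \<and> r' \<cdot>\<^bsub>D\<^esub> f = far W f \<cdot>\<^bsub>D\<^esub> r},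
      Dom = (\<lambda>(P, f, Q). P),
      Cod = (\<lambda>(P, f, Q). Q),
      Ide = (\<lambda>(Y, r). ((Y, r), Ide D Y, (Y, r))),
      Cmp = tri_cmp D\<rparr>)"

definition cocomparison_functor ::
  "('o, 'm) cat \<Rightarrow> ('o, 'm, 'p, 'n) funct \<Rightarrow> ('o \<Rightarrow> 'm) \<Rightarrow>
   ('o, 'm, 'p \<times> 'n, ('p \<times> 'n, 'n) tri) funct" where
  "cocomparison_functor C F \<eta> = (let K = (\<lambda>X. (fob F X, far F (\<eta> X))) in
     \<lparr>fob = K, far = (\<lambda>f. (K (Dom C f), far F f, K (Cod C f)))\<rparr>)"

section \<open>The monad and the comonad of an adjunction\<close>

context category
begin

lemma Hom_Ob: "f \<in> Hom C X Y \<Longrightarrow> X \<in> Ob C \<and> Y \<in> Ob C"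
  using Dom_Ob Cod_Ob by (auto simp: Hom_def)

end

lemma cat_functor_idfun: "category C \<Longrightarrow> cat_functor C C idfun"
  by (simp add: cat_functor_def cat_functor_axioms_def idfun_def category.Ide_Hom category.Cmp_Hom)

lemma cat_functor_fcomp:
  assumes "cat_functor A B T" and "cat_functor B E S"
  shows "cat_functor A E (S \<circ>\<^sub>F T)"
proof -
  interpret T: cat_functor A B T by fact
  interpret S: cat_functor B E S by fact
  show ?thesis
    by unfold_locales
      (auto simp: fcomp_def T.fob_Ob S.fob_Ob T.far_Ide S.far_Ide T.far_Cmp
        S.far_Cmp[OF T.far_Hom T.far_Hom] intro: T.far_Hom S.far_Hom)
qed

context adjunction
begin

lemma unit_Hom: "X \<in> Ob C \<Longrightarrow> \<eta> X \<in> Hom C X (fob G (fob F X))"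
  using unit.component[of X] by (simp add: idfun_def fcomp_def)

lemma unit_nat: "f \<in> Hom C X Y \<Longrightarrow> \<eta> Y \<cdot>\<^bsub>C\<^esub> f = far G (far F f) \<cdot>\<^bsub>C\<^esub> \<eta> X"
  using unit.naturality[of f X Y] by (simp add: idfun_def fcomp_def)

lemma counit_Hom: "Y \<in> Ob D \<Longrightarrow> \<epsilon> Y \<in> Hom D (fob F (fob G Y)) Y"
  using counit.component[of Y] by (simp add: idfun_def fcomp_def)

lemma counit_nat: "f \<in> Hom D X Y \<Longrightarrow> \<epsilon> Y \<cdot>\<^bsub>D\<^esub> far F (far G f) = f \<cdot>\<^bsub>D\<^esub> \<epsilon> X"
  using counit.naturality[of f X Y] by (simp add: idfun_def fcomp_def)

lemma monad_of_adjunction: "monad C (G \<circ>\<^sub>F F) (\<lambda>X. far G (\<epsilon> (fob F X))) \<eta>"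
proof -
  have T: "cat_functor C C (G \<circ>\<^sub>F F)"
    by (rule cat_functor_fcomp[OF F.cat_functor_axioms G.cat_functor_axioms])
  interpret T: cat_functor C C "G \<circ>\<^sub>F F" by (rule T)
  interpret TT: cat_functor C C "(G \<circ>\<^sub>F F) \<circ>\<^sub>F (G \<circ>\<^sub>F F)"
    by (rule cat_functor_fcomp[OF T T])
  note hom = F.fob_Ob G.fob_Ob counit_Hom unit_Hom F.far_Hom G.far_Hom
  have nat: "far G (\<epsilon> Y) \<cdot>\<^bsub>C\<^esub> far G (far F (far G f)) = far G f \<cdot>\<^bsub>C\<^esub> far G (\<epsilon> X)"
    if f: "f \<in> Hom D X Y" for f X Y
  proof -
    have o: "X \<in> Ob D" "Y \<in> Ob D" using D.Hom_Ob[OF f] by auto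
    show ?thesis
      using G.far_Cmp[OF F.far_Hom[OF G.far_Hom[OF f]] counit_Hom[OF o(2)]]
        G.far_Cmp[OF counit_Hom[OF o(1)] f] counit_nat[OF f] by simp
  qed
  show ?thesis
  proof unfold_locales
    show "far G (\<epsilon> (fob F X)) \<cdot>\<^bsub>C\<^esub> far (G \<circ>\<^sub>F F) (\<eta> X) = Ide C (fob (G \<circ>\<^sub>F F) X)"
      if X: "X \<in> Ob C" for X
      using G.far_Cmp[OF F.far_Hom[OF unit_Hom[OF X]] counit_Hom[OF F.fob_Ob[OF X]]]
        triangle_F[OF X] G.far_Ide[OF F.fob_Ob[OF X]] by (simp add: fcomp_def)
  qed (auto simp: fcomp_def hom nat triangle_G)
qed

lemma comonad_of_adjunction: "comonad D (F \<circ>\<^sub>F G) (\<lambda>Y. far F (\<eta> (fob G Y))) \<epsilon>"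
proof -
  have W: "cat_functor D D (F \<circ>\<^sub>F G)"
    by (rule cat_functor_fcomp[OF G.cat_functor_axioms F.cat_functor_axioms])
  interpret W: cat_functor D D "F \<circ>\<^sub>F G" by (rule W)
  interpret WW: cat_functor D D "(F \<circ>\<^sub>F G) \<circ>\<^sub>F (F \<circ>\<^sub>F G)"
    by (rule cat_functor_fcomp[OF W W])
  note hom = F.fob_Ob G.fob_Ob counit_Hom unit_Hom F.far_Hom G.far_Hom
  have nat: "far F (\<eta> Y) \<cdot>\<^bsub>D\<^esub> far F f = far F (far G (far F f)) \<cdot>\<^bsub>D\<^esub> far F (\<eta> X)"
    if f: "f \<in> Hom C X Y" for f X Y
  proof -
    have o: "X \<in> Ob C" "Y \<in> Ob C" using C.Hom_Ob[OF f] by auto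
    show ?thesis
      using F.far_Cmp[OF f unit_Hom[OF o(2)]]
        F.far_Cmp[OF unit_Hom[OF o(1)] G.far_Hom[OF F.far_Hom[OF f]]] unit_nat[OF f] by simp
  qed
  show ?thesis
  proof unfold_locales
    show "far (F \<circ>\<^sub>F G) (\<epsilon> Y) \<cdot>\<^bsub>D\<^esub> far F (\<eta> (fob G Y)) = Ide D (fob (F \<circ>\<^sub>F G) Y)"
      if Y: "Y \<in> Ob D" for Y
      using F.far_Cmp[OF unit_Hom[OF G.fob_Ob[OF Y]] G.far_Hom[OF counit_Hom[OF Y]]]
        triangle_G[OF Y] F.far_Ide[OF G.fob_Ob[OF Y]] by (simp add: fcomp_def)
  qed (auto simp: fcomp_def hom nat[symmetric] nat triangle_F)
qed

end

end

theory Submission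
  imports Defs
begin

text \<open>
  If the monad is separable via \<open>\<sigma>\<close>, then every module \<open>(X, h)\<close> is a retract of the free module
  \<open>K (F X)\<close>: the map \<open>T h \<cdot> \<sigma>\<^sub>X \<cdot> \<eta>\<^sub>X\<close> is a module section of \<open>h\<close>. The comparison functor \<open>K\<close> is
  bijective on the arrows out of \<open>F X\<close>, so the idempotent of \<open>K (F X)\<close> that splits through a retract
  of \<open>(X, h)\<close> comes from an idempotent \<open>e\<close> of \<open>F X\<close>. In the idempotent completions every object is
  therefore isomorphic to the image of some \<open>(F X, e)\<close>, and the completed functor is still bijective on
  the arrows out of \<open>(F X, e)\<close>; choosing such objects yields a fully faithful left adjoint.
  The statement on comonads is the same statement for the opposite categories.
\<close>

section \<open>Composable arrows\<close>

context category
begin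

lemma Cmp_assoc': "\<lbrakk>f \<in> Hom C X Y; g \<in> Hom C Y Z; h \<in> Hom C Z W\<rbrakk> \<Longrightarrow> (h \<cdot> g) \<cdot> f = h \<cdot> (g \<cdot> f)"
  by (simp add: Cmp_assoc)

text \<open>Associativity holds only for arrows with known ends, so it does not apply freely. This
  form lets an equation for \<open>g \<cdot> f\<close> act at the head of a longer composite nested
  to the right.\<close>

lemma Cmp_reduce:
  assumes "g \<cdot> f = k" "f \<in> Hom C X Y" "g \<in> Hom C Y Z" "x \<in> Hom C W X"
  shows "g \<cdot> (f \<cdot> x) = k \<cdot> x"
  using assms Cmp_assoc[of x W X f Y g Z] by simp

end

section \<open>Opposite categories\<close>

definition opc :: "('o, 'm) cat \<Rightarrow> ('o, 'm) cat" where
  "opc C = \<lparr>Ob = Ob C, Ar = Ar C, Dom = Cod C, Cod = Dom C, Ide = Ide C, Cmp = (\<lambda>g f. f \<cdot>\<^bsub>C\<^esub> g)\<rparr>"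

lemma opc_simps [simp]:
  "Ob (opc C) = Ob C" "Ar (opc C) = Ar C" "Dom (opc C) = Cod C" "Cod (opc C) = Dom C"
  "Ide (opc C) = Ide C" "g \<cdot>\<^bsub>opc C\<^esub> f = f \<cdot>\<^bsub>C\<^esub> g" "Hom (opc C) X Y = Hom C Y X"
  by (auto simp: opc_def Hom_def)

lemma opc_opc [simp]: "opc (opc C) = C"
  by (simp add: opc_def)

lemma category_opc: "category C \<Longrightarrow> category (opc C)"
  unfolding category_def by simp metis

lemma cat_functor_opc: "cat_functor A B T \<Longrightarrow> cat_functor (opc A) (opc B) T"
  unfolding cat_functor_def cat_functor_axioms_def by (simp add: category_opc) metis

lemma nat_trans_opc: "nat_trans A B S T \<alpha> \<Longrightarrow> nat_trans (opc A) (opc B) T S \<alpha>"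
  unfolding nat_trans_def nat_trans_axioms_def by (simp add: cat_functor_opc)

lemma adjunction_opc: "adjunction C D F G \<eta> \<epsilon> \<Longrightarrow> adjunction (opc D) (opc C) G F \<epsilon> \<eta>"
  unfolding adjunction_def adjunction_axioms_def
  by (simp add: category_opc cat_functor_opc nat_trans_opc)

lemma fully_faithful_opc: "fully_faithful A B T \<Longrightarrow> fully_faithful (opc A) (opc B) T"
  unfolding fully_faithful_def by (simp add: cat_functor_opc)

text \<open>Reversing arrows exchanges the two adjoints, the unit with the counit and one triangle
  identity with the other, while full faithfulness is self-dual. A fully faithful left adjoint of
  \<open>T\<close> between the opposites is thus a fully faithful right adjoint of \<open>T\<close>
  itself.\<close>

lemma reflection_opc:
  assumes "coreflection (opc A) (opc B) T"
  shows "reflection A B T"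
  using assms adjunction_opc[of "opc B" "opc A"] fully_faithful_opc[of "opc B" "opc A"]
  unfolding reflection_def coreflection_def by fastforce

text \<open>The coseparability map \<tau> serves unchanged as \<sigma>: reversing composition fixes
  the middle term of the chain of two equations and swaps the outer ones.\<close>

lemma separable_monad_opc:
  assumes "coseparable_comonad D W \<Delta> \<epsilon>"
  shows "separable_monad (opc D) W \<Delta> \<epsilon>"
proof -
  interpret comonad D W \<Delta> \<epsilon> using assms by (simp add: coseparable_comonad_def)
  have "monad (opc D) W \<Delta> \<epsilon>"
    unfolding monad_def monad_axioms_def
    using nat_trans_opc comult.nat_trans_axioms counit.nat_trans_axioms
    by (auto simp: comult_coassoc comult_counit_left comult_counit_right)
  moreover obtain \<tau> where "nat_trans D D (W \<circ>\<^sub>F W) W \<tau>"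
    "\<forall>Y \<in> Ob D. \<tau> Y \<cdot>\<^bsub>D\<^esub> \<Delta> Y = Ide D (fob W Y) \<and>
          far W (\<tau> Y) \<cdot>\<^bsub>D\<^esub> \<Delta> (fob W Y) = \<Delta> Y \<cdot>\<^bsub>D\<^esub> \<tau> Y \<and>
          \<Delta> Y \<cdot>\<^bsub>D\<^esub> \<tau> Y = \<tau> (fob W Y) \<cdot>\<^bsub>D\<^esub> far W (\<Delta> Y)"
    using assms unfolding coseparable_comonad_def by blast
  ultimately show ?thesis
    unfolding separable_monad_def by (auto intro!: exI[of _ \<tau>] nat_trans_opc)
qed

section \<open>Coreflections from local full faithfulness\<close>

text \<open>Full faithfulness with one fixed source. For a functor \<open>T\<close> it says that the
  identity of \<open>fob T X\<close> is a universal arrow from \<open>fob T X\<close> to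
  \<open>T\<close>, so \<open>X\<close> is a value that a left adjoint may take at
  \<open>fob T X\<close>.\<close>

definition ff_from ::
  "('o, 'm) cat \<Rightarrow> ('p, 'n) cat \<Rightarrow> ('o, 'm, 'p, 'n) funct \<Rightarrow> 'o \<Rightarrow> bool" where
  "ff_from A B T X \<longleftrightarrow> X \<in> Ob A \<and>
     (\<forall>Y \<in> Ob A. bij_betw (far T) (Hom A X Y) (Hom B (fob T X) (fob T Y)))"

lemma ff_from_inj:
  assumes "category A" "ff_from A B T X" "f \<in> Hom A X Y" "g \<in> Hom A X Y" "far T f = far T g"
  shows "f = g"
  using assms category.Hom_Ob[OF assms(1,3)]
  by (auto simp: ff_from_def bij_betw_def inj_on_def)

lemma ff_from_surj:
  assumes "ff_from A B T X" "Y \<in> Ob A" "g \<in> Hom B (fob T X) (fob T Y)"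
  obtains f where "f \<in> Hom A X Y" "far T f = g"
  using assms unfolding ff_from_def bij_betw_def by (metis imageE)

text \<open>By \<open>ff_from\<close>, the isomorphism \<open>u\<close> from \<open>P\<close> to
  \<open>fob T X\<close> is a universal arrow from \<open>P\<close> to \<open>T\<close>. Choosing
  one for every \<open>P\<close> therefore defines a left adjoint with unit \<open>u\<close>, and a
  left adjoint with invertible unit is fully faithful.\<close>

lemma coreflectionI:
  assumes T: "cat_functor A B T"
    and ex: "\<And>P. P \<in> Ob B \<Longrightarrow> \<exists>X u v. ff_from A B T X \<and>
      u \<in> Hom B P (fob T X) \<and> v \<in> Hom B (fob T X) P \<and>
      v \<cdot>\<^bsub>B\<^esub> u = Ide B P \<and> u \<cdot>\<^bsub>B\<^esub> v = Ide B (fob T X)"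
  shows "coreflection A B T"
proof -
  interpret T: cat_functor A B T by fact
  obtain l u v where luv: "\<And>P. P \<in> Ob B \<Longrightarrow> ff_from A B T (l P) \<and>
      u P \<in> Hom B P (fob T (l P)) \<and> v P \<in> Hom B (fob T (l P)) P \<and>
      v P \<cdot>\<^bsub>B\<^esub> u P = Ide B P \<and> u P \<cdot>\<^bsub>B\<^esub> v P = Ide B (fob T (l P))"
    using ex by metis
  then have ff: "\<And>P. P \<in> Ob B \<Longrightarrow> ff_from A B T (l P)"
    and u: "\<And>P. P \<in> Ob B \<Longrightarrow> u P \<in> Hom B P (fob T (l P))"
    and v: "\<And>P. P \<in> Ob B \<Longrightarrow> v P \<in> Hom B (fob T (l P)) P"
    and vu: "\<And>P. P \<in> Ob B \<Longrightarrow> v P \<cdot>\<^bsub>B\<^esub> u P = Ide B P"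
    and uv: "\<And>P. P \<in> Ob B \<Longrightarrow> u P \<cdot>\<^bsub>B\<^esub> v P = Ide B (fob T (l P))"
    by blast+
  have l: "P \<in> Ob B \<Longrightarrow> l P \<in> Ob A" for P
    using ff by (simp add: ff_from_def)
  \<comment> \<open>Arrows of \<open>A\<close> out of a chosen object \<open>l P\<close> agree once
    their images under \<open>T\<close> agree. The functor laws of \<open>L\<close> and the
    adjunction equations that live in \<open>A\<close> are all verified after applying
    \<open>T\<close>.\<close>
  note eqI = ff_from_inj[OF T.A.category_axioms ff]
  have lift: "\<exists>f \<in> Hom A (l P) Y. far T f = g"
    if "P \<in> Ob B" "Y \<in> Ob A" "g \<in> Hom B (fob T (l P)) (fob T Y)" for P Y g
    using ff_from_surj[OF ff that(2,3)] that(1) by metis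
  \<comment> \<open>On arrows, \<open>L\<close> takes the preimage under \<open>T\<close> of
    \<open>f\<close> conjugated by the chosen isomorphisms; it exists and is unique by
    \<open>ff_from\<close>.\<close>
  define L where "L = \<lparr>fob = l, far = (\<lambda>f. SOME k. k \<in> Hom A (l (Dom B f)) (l (Cod B f)) \<and>
      far T k = u (Cod B f) \<cdot>\<^bsub>B\<^esub> (f \<cdot>\<^bsub>B\<^esub> v (Dom B f)))\<rparr>"
  have fobL: "fob L P = l P" for P by (simp add: L_def)
  have L: "far L f \<in> Hom A (l P) (l Q) \<and> far T (far L f) = u Q \<cdot>\<^bsub>B\<^esub> (f \<cdot>\<^bsub>B\<^esub> v P)"
    if f: "f \<in> Hom B P Q" for f P Q
  proof -
    have o: "P \<in> Ob B" "Q \<in> Ob B" using T.B.Hom_Ob[OF f] by auto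
    have d: "Dom B f = P" "Cod B f = Q" using f by (auto simp: Hom_def)
    have "u Q \<cdot>\<^bsub>B\<^esub> (f \<cdot>\<^bsub>B\<^esub> v P) \<in> Hom B (fob T (l P)) (fob T (l Q))"
      by (rule T.B.Cmp_Hom[OF T.B.Cmp_Hom[OF v[OF o(1)] f] u[OF o(2)]])
    from lift[OF o(1) l[OF o(2)] this] show ?thesis
      unfolding L_def d funct.simps by - (rule someI_ex, blast)
  qed
  note LHom = L[THEN conjunct1] and TL = L[THEN conjunct2]
  have comp_uv: "(u R \<cdot>\<^bsub>B\<^esub> (g \<cdot>\<^bsub>B\<^esub> v Q)) \<cdot>\<^bsub>B\<^esub> (u Q \<cdot>\<^bsub>B\<^esub> k) = u R \<cdot>\<^bsub>B\<^esub> (g \<cdot>\<^bsub>B\<^esub> k)"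
    if g: "g \<in> Hom B Q R" and k: "k \<in> Hom B P Q" for g k P Q R
  proof -
    have o: "Q \<in> Ob B" "R \<in> Ob B" using T.B.Hom_Ob[OF g] by auto
    note vQ = v[OF o(1)] and uQ = u[OF o(1)] and uR = u[OF o(2)]
    have "v Q \<cdot>\<^bsub>B\<^esub> (u Q \<cdot>\<^bsub>B\<^esub> k) = k"
      using T.B.Cmp_reduce[OF vu[OF o(1)] uQ vQ k] T.B.Ide_Cmp[OF k] by simp
    then show ?thesis
      using T.B.Cmp_assoc'[OF T.B.Cmp_Hom[OF k uQ] T.B.Cmp_Hom[OF vQ g] uR]
        T.B.Cmp_assoc'[OF T.B.Cmp_Hom[OF k uQ] vQ g] by simp
  qed
  have L_functor: "cat_functor B A L"
  proof unfold_locales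
    fix P assume P: "P \<in> Ob B"
    have I: "Ide B P \<in> Hom B P P" by (rule T.B.Ide_Hom[OF P])
    show "far L (Ide B P) = Ide A (fob L P)"
      unfolding fobL
      by (rule eqI[OF P LHom[OF I] T.A.Ide_Hom[OF l[OF P]]])
        (simp add: TL[OF I] T.far_Ide[OF l[OF P]] T.B.Ide_Cmp[OF v[OF P]] uv[OF P])
  next
    fix f g P Q R assume f: "f \<in> Hom B P Q" and g: "g \<in> Hom B Q R"
    have o: "P \<in> Ob B" "Q \<in> Ob B" "R \<in> Ob B" using T.B.Hom_Ob[OF f] T.B.Hom_Ob[OF g] by auto
    have gf: "g \<cdot>\<^bsub>B\<^esub> f \<in> Hom B P R" by (rule T.B.Cmp_Hom[OF f g])
    have "far T (far L (g \<cdot>\<^bsub>B\<^esub> f)) = far T (far L g \<cdot>\<^bsub>A\<^esub> far L f)"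
      using comp_uv[OF g T.B.Cmp_Hom[OF v[OF o(1)] f]] T.B.Cmp_assoc'[OF v[OF o(1)] f g]
      by (simp add: TL[OF gf] T.far_Cmp[OF LHom[OF f] LHom[OF g]] TL[OF f] TL[OF g])
    then show "far L (g \<cdot>\<^bsub>B\<^esub> f) = far L g \<cdot>\<^bsub>A\<^esub> far L f"
      by (rule eqI[OF o(1) LHom[OF gf] T.A.Cmp_Hom[OF LHom[OF f] LHom[OF g]]])
  qed (auto simp: fobL l LHom)
  interpret L: cat_functor B A L by fact
  \<comment> \<open>The counit is the lift of the inverse of the unit at \<open>fob T Y\<close>,
    which makes the triangle identity for \<open>T\<close> the equation \<open>vu\<close>.\<close>
  define c where "c Y = (SOME k. k \<in> Hom A (l (fob T Y)) Y \<and> far T k = v (fob T Y))" for Y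
  have c: "c Y \<in> Hom A (l (fob T Y)) Y \<and> far T (c Y) = v (fob T Y)" if "Y \<in> Ob A" for Y
    using lift[OF T.fob_Ob[OF that] that v[OF T.fob_Ob[OF that]]]
    unfolding c_def by - (rule someI_ex, blast)
  note cHom = c[THEN conjunct1] and Tc = c[THEN conjunct2]
  have "adjunction B A L T u c"
  proof (intro adjunction.intro nat_trans.intro nat_trans_axioms.intro adjunction_axioms.intro
      cat_functor_idfun cat_functor_fcomp[OF L_functor T] cat_functor_fcomp[OF T L_functor]
      L_functor T T.A.category_axioms T.B.category_axioms)
    fix P assume P: "P \<in> Ob B"
    show "u P \<in> Hom B (fob idfun P) (fob (T \<circ>\<^sub>F L) P)"
      by (simp add: idfun_def fcomp_def fobL u[OF P])
    note lP = l[OF P]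
    note TlP = T.fob_Ob[OF lP]
    have 1: "far L (u P) \<in> Hom A (l P) (l (fob T (l P)))" by (rule LHom[OF u[OF P]])
    have 2: "c (l P) \<in> Hom A (l (fob T (l P))) (l P)" by (rule cHom[OF lP])
    \<comment> \<open>This is the image under \<open>T\<close> of the triangle identity for
      \<open>L\<close>.\<close>
    have "v (fob T (l P)) \<cdot>\<^bsub>B\<^esub> (u (fob T (l P)) \<cdot>\<^bsub>B\<^esub> (u P \<cdot>\<^bsub>B\<^esub> v P)) = Ide B (fob T (l P))"
      using T.B.Cmp_Ide[OF u[OF TlP]] vu[OF TlP] uv[OF P] by simp
    then show "c (fob L P) \<cdot>\<^bsub>A\<^esub> far L (u P) = Ide A (fob L P)"
      unfolding fobL
      by - (rule eqI[OF P T.A.Cmp_Hom[OF 1 2] T.A.Ide_Hom[OF lP]],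
          simp add: T.far_Cmp[OF 1 2] Tc[OF lP] TL[OF u[OF P]] T.far_Ide[OF lP])
  next
    fix f P Q assume f: "f \<in> Hom B P Q"
    have o: "P \<in> Ob B" "Q \<in> Ob B" using T.B.Hom_Ob[OF f] by auto
    show "u Q \<cdot>\<^bsub>B\<^esub> far idfun f = far (T \<circ>\<^sub>F L) f \<cdot>\<^bsub>B\<^esub> u P"
      using T.B.Cmp_assoc'[OF u[OF o(1)] T.B.Cmp_Hom[OF v[OF o(1)] f] u[OF o(2)]]
        T.B.Cmp_assoc'[OF u[OF o(1)] v[OF o(1)] f] vu[OF o(1)] T.B.Cmp_Ide[OF f]
      by (simp add: idfun_def fcomp_def TL[OF f])
  next
    fix Y assume Y: "Y \<in> Ob A"
    show "c Y \<in> Hom A (fob (L \<circ>\<^sub>F T) Y) (fob idfun Y)"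
      by (simp add: idfun_def fcomp_def fobL cHom[OF Y])
    show "far T (c Y) \<cdot>\<^bsub>B\<^esub> u (fob T Y) = Ide B (fob T Y)"
      by (simp add: Tc[OF Y] vu[OF T.fob_Ob[OF Y]])
  next
    fix f X Y assume f: "f \<in> Hom A X Y"
    have o: "X \<in> Ob A" "Y \<in> Ob A" using T.A.Hom_Ob[OF f] by auto
    note Tf = T.far_Hom[OF f]
    note TX = T.fob_Ob[OF o(1)] and TY = T.fob_Ob[OF o(2)]
    note LTf = LHom[OF Tf] and cX = cHom[OF o(1)] and cY = cHom[OF o(2)]
    have "far T (c Y \<cdot>\<^bsub>A\<^esub> far L (far T f)) = far T (f \<cdot>\<^bsub>A\<^esub> c X)"
      using T.B.Cmp_reduce[OF vu[OF TY] u[OF TY] v[OF TY] T.B.Cmp_Hom[OF v[OF TX] Tf]]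
        T.B.Ide_Cmp[OF T.B.Cmp_Hom[OF v[OF TX] Tf]]
      by (simp add: T.far_Cmp[OF LTf cY] T.far_Cmp[OF cX f] TL[OF Tf] Tc o)
    then have "c Y \<cdot>\<^bsub>A\<^esub> far L (far T f) = f \<cdot>\<^bsub>A\<^esub> c X"
      by (rule eqI[OF TX T.A.Cmp_Hom[OF LTf cY] T.A.Cmp_Hom[OF cX f]])
    then show "c Y \<cdot>\<^bsub>A\<^esub> far (L \<circ>\<^sub>F T) f = far idfun f \<cdot>\<^bsub>A\<^esub> c X"
      by (simp add: idfun_def fcomp_def)
  qed
  moreover have "fully_faithful B A L"
    unfolding fully_faithful_def
  proof (intro conjI ballI L_functor)
    fix P Q assume P: "P \<in> Ob B" and Q: "Q \<in> Ob B"
    \<comment> \<open>Conjugating \<open>far T (far L f)\<close> back recovers \<open>f\<close>,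
      hence injectivity. The same formula applied to \<open>far T g\<close> gives the preimage of
      \<open>g\<close> below.\<close>
    have inv1: "v Q \<cdot>\<^bsub>B\<^esub> ((u Q \<cdot>\<^bsub>B\<^esub> (f \<cdot>\<^bsub>B\<^esub> v P)) \<cdot>\<^bsub>B\<^esub> u P) = f" if f: "f \<in> Hom B P Q" for f
      using T.B.Cmp_assoc'[OF u[OF P] T.B.Cmp_Hom[OF v[OF P] f] u[OF Q]]
        T.B.Cmp_assoc'[OF u[OF P] v[OF P] f] vu[OF P] T.B.Cmp_Ide[OF f]
        T.B.Cmp_reduce[OF vu[OF Q] u[OF Q] v[OF Q] f] T.B.Ide_Cmp[OF f] by simp
    have "\<exists>f \<in> Hom B P Q. g = far L f" if g: "g \<in> Hom A (l P) (l Q)" for g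
    proof
      note Tg = T.far_Hom[OF g]
      note Tgu = T.B.Cmp_Hom[OF u[OF P] Tg]
      show f: "v Q \<cdot>\<^bsub>B\<^esub> (far T g \<cdot>\<^bsub>B\<^esub> u P) \<in> Hom B P Q"
        by (rule T.B.Cmp_Hom[OF Tgu v[OF Q]])
      have "far T g = far T (far L (v Q \<cdot>\<^bsub>B\<^esub> (far T g \<cdot>\<^bsub>B\<^esub> u P)))"
        using T.B.Cmp_assoc'[OF v[OF P] Tgu v[OF Q]] T.B.Cmp_assoc'[OF v[OF P] u[OF P] Tg]
          uv[OF P] T.B.Cmp_Ide[OF Tg] T.B.Cmp_reduce[OF uv[OF Q] v[OF Q] u[OF Q] Tg]
          T.B.Ide_Cmp[OF Tg]
        by (simp add: TL[OF f])
      then show "g = far L (v Q \<cdot>\<^bsub>B\<^esub> (far T g \<cdot>\<^bsub>B\<^esub> u P))"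
        by (rule eqI[OF P g LHom[OF f]])
    qed
    moreover have "inj_on (far L) (Hom B P Q)"
      by (rule inj_onI) (metis inv1 TL)
    ultimately show "bij_betw (far L) (Hom B P Q) (Hom A (fob L P) (fob L Q))"
      unfolding fobL bij_betw_def using LHom by auto
  qed
  ultimately show ?thesis
    unfolding coreflection_def by blast
qed


text \<open>This is \<open>coreflectionI\<close> for the opposite categories. Over
  \<open>opc A\<close> and \<open>opc B\<close>, \<open>ff_from\<close> concerns the arrows of
  \<open>A\<close> that end in \<open>X\<close>.\<close>

lemma reflectionI:
  assumes T: "cat_functor A B T"
    and ex: "\<And>P. P \<in> Ob B \<Longrightarrow> \<exists>X u v. ff_from (opc A) (opc B) T X \<and>
      u \<in> Hom B (fob T X) P \<and> v \<in> Hom B P (fob T X) \<and>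
      u \<cdot>\<^bsub>B\<^esub> v = Ide B P \<and> v \<cdot>\<^bsub>B\<^esub> u = Ide B (fob T X)"
  shows "reflection A B T"
  by (rule reflection_opc, rule coreflectionI[OF cat_functor_opc[OF T]]) (use ex in simp)

section \<open>Categories of triples\<close>

text \<open>Common shape of idempotent completions, modules and comodules, so that the category laws
  are proved once. The identity \<open>i x\<close> is a parameter because in an idempotent
  completion it is the idempotent itself rather than an identity of \<open>C\<close>.\<close>

definition tri_cat ::
  "('o, 'm) cat \<Rightarrow> 'x set \<Rightarrow> ('x \<Rightarrow> 'm) \<Rightarrow> ('x \<Rightarrow> 'x \<Rightarrow> 'm set) \<Rightarrow> ('x, ('x, 'm) tri) cat" where
  "tri_cat C V i H = \<lparr>Ob = V, Ar = {(x, f, y). x \<in> V \<and> y \<in> V \<and> f \<in> H x y},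
     Dom = (\<lambda>(x, f, y). x), Cod = (\<lambda>(x, f, y). y), Ide = (\<lambda>x. (x, i x, x)), Cmp = tri_cmp C\<rparr>"

lemma tri_cat_simps [simp]:
  "Ob (tri_cat C V i H) = V"
  "Ide (tri_cat C V i H) x = (x, i x, x)"
  "(y', g, z) \<cdot>\<^bsub>tri_cat C V i H\<^esub> (x, f, y) = (x, g \<cdot>\<^bsub>C\<^esub> f, z)"
  "Hom (tri_cat C V i H) x y = {(x, f, y) | f. x \<in> V \<and> y \<in> V \<and> f \<in> H x y}"
  by (auto simp: tri_cat_def tri_cmp_def Hom_def)

text \<open>Associativity is inherited from \<open>C\<close> through the underlying objects
  \<open>k x\<close>; the unit laws are hypotheses since \<open>i x\<close> may differ from the
  identity of \<open>k x\<close>.\<close>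

lemma category_tri_cat:
  assumes C: "category C"
    and H: "\<And>x y f. \<lbrakk>x \<in> V; y \<in> V; f \<in> H x y\<rbrakk> \<Longrightarrow> f \<in> Hom C (k x) (k y)"
    and cmp: "\<And>x y z f g. \<lbrakk>x \<in> V; y \<in> V; z \<in> V; f \<in> H x y; g \<in> H y z\<rbrakk> \<Longrightarrow> g \<cdot>\<^bsub>C\<^esub> f \<in> H x z"
    and ide: "\<And>x. x \<in> V \<Longrightarrow> i x \<in> H x x"
    and cmp_ide: "\<And>x y f. \<lbrakk>x \<in> V; y \<in> V; f \<in> H x y\<rbrakk> \<Longrightarrow> f \<cdot>\<^bsub>C\<^esub> i x = f"
    and ide_cmp: "\<And>x y f. \<lbrakk>x \<in> V; y \<in> V; f \<in> H x y\<rbrakk> \<Longrightarrow> i y \<cdot>\<^bsub>C\<^esub> f = f"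
  shows "category (tri_cat C V i H)"
proof
  fix f assume "f \<in> Ar (tri_cat C V i H)"
  then show "Dom (tri_cat C V i H) f \<in> Ob (tri_cat C V i H)"
    "Cod (tri_cat C V i H) f \<in> Ob (tri_cat C V i H)"
    by (auto simp: tri_cat_def)
next
  fix f g h x y z w
  assume "f \<in> Hom (tri_cat C V i H) x y" "g \<in> Hom (tri_cat C V i H) y z"
    "h \<in> Hom (tri_cat C V i H) z w"
  then show "h \<cdot>\<^bsub>tri_cat C V i H\<^esub> (g \<cdot>\<^bsub>tri_cat C V i H\<^esub> f) =
      (h \<cdot>\<^bsub>tri_cat C V i H\<^esub> g) \<cdot>\<^bsub>tri_cat C V i H\<^esub> f"
    by (auto intro: category.Cmp_assoc[OF C H H H])
qed (auto simp: ide cmp_ide ide_cmp intro: cmp)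

text \<open>Serves functors from a plain category to triples, such as the comparison functors;
  \<open>bij_betw_triples\<close> serves completed functors, whose arrows are triples on both
  sides.\<close>

lemma bij_betw_into_triples:
  assumes "bij_betw \<phi> S S'" "\<And>f. f \<in> S \<Longrightarrow> F f = (x, \<phi> f, y)"
  shows "bij_betw F S {(x, g, y) | g. g \<in> S'}"
proof (rule bij_betw_imageI)
  show "inj_on F S"
    using assms by (auto simp: inj_on_def bij_betw_def)
  show "F ` S = {(x, g, y) | g. g \<in> S'}"
    using assms by (force simp: bij_betw_def image_iff)
qed

lemma bij_betw_triples:
  assumes "bij_betw \<phi> S S'" "\<And>f. f \<in> S \<Longrightarrow> F (x, f, y) = (x', \<phi> f, y')"
  shows "bij_betw F {(x, f, y) | f. f \<in> S} {(x', g, y') | g. g \<in> S'}"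
proof (rule bij_betw_imageI)
  show "inj_on F {(x, f, y) | f. f \<in> S}"
    using assms by (auto simp: inj_on_def bij_betw_def)
  show "F ` {(x, f, y) | f. f \<in> S} = {(x', g, y') | g. g \<in> S'}"
    using assms by (force simp: bij_betw_def image_iff)
qed

section \<open>Idempotent completions\<close>

definition idem_objs :: "('o, 'm) cat \<Rightarrow> ('o \<times> 'm) set" where
  "idem_objs C = {(X, e). e \<in> Hom C X X \<and> e \<cdot>\<^bsub>C\<^esub> e = e}"

definition idem_hom :: "('o, 'm) cat \<Rightarrow> 'o \<times> 'm \<Rightarrow> 'o \<times> 'm \<Rightarrow> 'm set" where
  "idem_hom C = (\<lambda>(X, e) (Y, b). {f \<in> Hom C X Y. b \<cdot>\<^bsub>C\<^esub> f = f \<and> f \<cdot>\<^bsub>C\<^esub> e = f})"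

text \<open>Since \<open>e\<close> and \<open>b\<close> are idempotent, \<open>f = b f e\<close>
  splits into the one-sided equations \<open>b f = f\<close> and \<open>f e = f\<close>, which can
  be transported separately.\<close>

lemma idem_compl_eq:
  assumes "category C"
  shows "idem_compl C = tri_cat C (idem_objs C) snd (idem_hom C)"
proof -
  interpret category C by fact
  have hom: "f = b \<cdot>\<^bsub>C\<^esub> (f \<cdot>\<^bsub>C\<^esub> e) \<longleftrightarrow> b \<cdot>\<^bsub>C\<^esub> f = f \<and> f \<cdot>\<^bsub>C\<^esub> e = f"
    if e: "e \<in> Hom C X X" "e \<cdot>\<^bsub>C\<^esub> e = e" and b: "b \<in> Hom C Y Y" "b \<cdot>\<^bsub>C\<^esub> b = b"
      and f: "f \<in> Hom C X Y" for e b f X Y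
  proof
    assume eq: "f = b \<cdot>\<^bsub>C\<^esub> (f \<cdot>\<^bsub>C\<^esub> e)"
    have fe: "f \<cdot>\<^bsub>C\<^esub> e \<in> Hom C X Y" by (rule Cmp_Hom[OF e(1) f])
    have "b \<cdot>\<^bsub>C\<^esub> f = f"
      using Cmp_reduce[OF b(2,1,1) fe] eq by metis
    moreover have "f \<cdot>\<^bsub>C\<^esub> e = f"
      using Cmp_assoc[OF e(1) fe b(1)] Cmp_assoc[OF e(1) e(1) f] e(2) eq by metis
    ultimately show "b \<cdot>\<^bsub>C\<^esub> f = f \<and> f \<cdot>\<^bsub>C\<^esub> e = f" by blast
  qed simp
  have objs: "{(X, e). X \<in> Ob C \<and> e \<in> Hom C X X \<and> e \<cdot>\<^bsub>C\<^esub> e = e} = idem_objs C"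
    using Hom_Ob by (auto simp: idem_objs_def)
  show ?thesis
    unfolding idem_compl_def objs Let_def tri_cat_def
    by (auto simp: idem_objs_def idem_hom_def hom fun_eq_iff)
qed

lemma category_idem_compl:
  assumes "category C"
  shows "category (idem_compl C)"
proof -
  interpret category C by fact
  show ?thesis
    unfolding idem_compl_eq[OF assms]
  proof (rule category_tri_cat[OF assms, where k = fst])
    fix x y z f g
    assume "x \<in> idem_objs C" "y \<in> idem_objs C" "z \<in> idem_objs C"
      and "f \<in> idem_hom C x y" "g \<in> idem_hom C y z"
    then show "g \<cdot>\<^bsub>C\<^esub> f \<in> idem_hom C x z"
      using Cmp_assoc[of f "fst x" "fst y" g "fst z" "snd z" "fst z"]
        Cmp_assoc'[of "snd x" "fst x" "fst x" f "fst y" g "fst z"]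
        Cmp_Hom[of f "fst x" "fst y" g "fst z"]
      by (auto simp: idem_objs_def idem_hom_def split: prod.splits)
  qed (auto simp: idem_objs_def idem_hom_def)
qed

lemma idem_objs_far:
  assumes "cat_functor A B T" "(X, e) \<in> idem_objs A"
  shows "(fob T X, far T e) \<in> idem_objs B"
proof -
  interpret T: cat_functor A B T by fact
  show ?thesis
    using assms(2) T.far_Hom T.far_Cmp[of e X X e X] by (auto simp: idem_objs_def)
qed

lemma idem_hom_far:
  assumes "cat_functor A B T" "(X, e) \<in> idem_objs A" "(Y, b) \<in> idem_objs A"
    and "f \<in> idem_hom A (X, e) (Y, b)"
  shows "far T f \<in> idem_hom B (fob T X, far T e) (fob T Y, far T b)"
proof -
  interpret T: cat_functor A B T by fact
  show ?thesis
    using assms(2-) T.far_Hom T.far_Cmp[of e X X f Y] T.far_Cmp[of f X Y b Y]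
    by (auto simp: idem_objs_def idem_hom_def)
qed

lemma idem_compl_functor_simps [simp]:
  "fob (idem_compl_functor T) (X, e) = (fob T X, far T e)"
  "far (idem_compl_functor T) ((X, e), f, (Y, b)) = ((fob T X, far T e), far T f, (fob T Y, far T b))"
  by (simp_all add: idem_compl_functor_def)

lemma cat_functor_idem_compl:
  assumes "cat_functor A B T"
  shows "cat_functor (idem_compl A) (idem_compl B) (idem_compl_functor T)"
proof -
  interpret T: cat_functor A B T by fact
  have A: "category A" and B: "category B" by unfold_locales
  show ?thesis
  proof (intro cat_functor.intro cat_functor_axioms.intro category_idem_compl A B)
    fix f g x y z assume "f \<in> Hom (idem_compl A) x y" "g \<in> Hom (idem_compl A) y z"
    then show "far (idem_compl_functor T) (g \<cdot>\<^bsub>idem_compl A\<^esub> f) =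
        far (idem_compl_functor T) g \<cdot>\<^bsub>idem_compl B\<^esub> far (idem_compl_functor T) f"
      by (cases x; cases y; cases z) (auto simp: idem_compl_eq A B idem_hom_def T.far_Cmp)
  next
    fix f x y assume "f \<in> Hom (idem_compl A) x y"
    then show "far (idem_compl_functor T) f \<in>
        Hom (idem_compl B) (fob (idem_compl_functor T) x) (fob (idem_compl_functor T) y)"
      by (cases x; cases y)
        (auto simp: idem_compl_eq A B idem_objs_far[OF assms] idem_hom_far[OF assms])
  qed (auto simp: idem_compl_eq A B idem_objs_far[OF assms])
qed

text \<open>The bijection on arrows out of \<open>X\<close> restricts. If \<open>far T f\<close>
  absorbs \<open>far T e\<close> and \<open>far T b\<close>, then \<open>f\<close> absorbs
  \<open>e\<close> and \<open>b\<close>, because \<open>f e\<close> and \<open>b f\<close> are again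
  arrows out of \<open>X\<close> and \<open>T\<close> is injective on those.\<close>

lemma ff_from_idem_bij:
  assumes T: "cat_functor A B T" and ff: "ff_from A B T X"
    and e: "(X, e) \<in> idem_objs A" and b: "(Y, b) \<in> idem_objs A"
  shows "bij_betw (far T) (idem_hom A (X, e) (Y, b))
    (idem_hom B (fob T X, far T e) (fob T Y, far T b))"
proof (rule bij_betw_imageI)
  interpret T: cat_functor A B T by fact
  have eH: "e \<in> Hom A X X" and bH: "b \<in> Hom A Y Y"
    using e b by (auto simp: idem_objs_def)
  have Y: "Y \<in> Ob A" using T.A.Hom_Ob[OF bH] by simp
  note eqI = ff_from_inj[OF T.A.category_axioms ff]
  show "inj_on (far T) (idem_hom A (X, e) (Y, b))"
    by (rule inj_onI) (auto simp: idem_hom_def intro: eqI)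
  show "far T ` idem_hom A (X, e) (Y, b) = idem_hom B (fob T X, far T e) (fob T Y, far T b)"
  proof (intro subset_antisym subsetI)
    fix g assume g: "g \<in> idem_hom B (fob T X, far T e) (fob T Y, far T b)"
    then obtain f where f: "f \<in> Hom A X Y" "far T f = g"
      using ff_from_surj[OF ff Y] by (auto simp: idem_hom_def)
    have "b \<cdot>\<^bsub>A\<^esub> f = f" "f \<cdot>\<^bsub>A\<^esub> e = f"
      using g f T.far_Cmp[OF f(1) bH] T.far_Cmp[OF eH f(1)]
      by (auto simp: idem_hom_def intro!: eqI[OF _ f(1)] T.A.Cmp_Hom[OF f(1) bH] T.A.Cmp_Hom[OF eH f(1)])
    then show "g \<in> far T ` idem_hom A (X, e) (Y, b)"
      using f by (auto simp: idem_hom_def)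
  qed (use idem_hom_far[OF T e b] in auto)
qed

text \<open>The endomorphism \<open>s a r\<close> of \<open>fob T X\<close> is idempotent since
  \<open>r s\<close> is the identity. It lifts to some \<open>e\<close>, idempotent by injectivity
  of \<open>T\<close>. With \<open>u = s a\<close> and \<open>v = a r\<close>, the retract becomes
  an isomorphism between \<open>(P, a)\<close> and the image of \<open>(X, e)\<close> in the
  completion.\<close>

lemma split_retract:
  assumes T: "cat_functor A B T" and ff: "ff_from A B T X"
    and s: "s \<in> Hom B P (fob T X)" and r: "r \<in> Hom B (fob T X) P"
    and rs: "r \<cdot>\<^bsub>B\<^esub> s = Ide B P" and a: "(P, a) \<in> idem_objs B"
  shows "\<exists>e u v. (X, e) \<in> idem_objs A \<and>
    u \<in> idem_hom B (P, a) (fob T X, far T e) \<and> v \<in> idem_hom B (fob T X, far T e) (P, a) \<and>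
    v \<cdot>\<^bsub>B\<^esub> u = a \<and> u \<cdot>\<^bsub>B\<^esub> v = far T e"
proof -
  interpret T: cat_functor A B T by fact
  have aH: "a \<in> Hom B P P" and aa: "a \<cdot>\<^bsub>B\<^esub> a = a" using a by (auto simp: idem_objs_def)
  have X: "X \<in> Ob A" using ff by (simp add: ff_from_def)
  have rsx: "r \<cdot>\<^bsub>B\<^esub> (s \<cdot>\<^bsub>B\<^esub> x) = x" if "x \<in> Hom B W P" for x W
    using T.B.Cmp_reduce[OF rs s r that] T.B.Ide_Cmp[OF that] by simp
  have aax: "a \<cdot>\<^bsub>B\<^esub> (a \<cdot>\<^bsub>B\<^esub> x) = a \<cdot>\<^bsub>B\<^esub> x" if "x \<in> Hom B W P" for x W
    using T.B.Cmp_reduce[OF aa aH aH that] .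
  have ar: "a \<cdot>\<^bsub>B\<^esub> r \<in> Hom B (fob T X) P" by (rule T.B.Cmp_Hom[OF r aH])
  have sa: "s \<cdot>\<^bsub>B\<^esub> a \<in> Hom B P (fob T X)" by (rule T.B.Cmp_Hom[OF aH s])
  have sar: "s \<cdot>\<^bsub>B\<^esub> (a \<cdot>\<^bsub>B\<^esub> r) \<in> Hom B (fob T X) (fob T X)" by (rule T.B.Cmp_Hom[OF ar s])
  have arx: "(a \<cdot>\<^bsub>B\<^esub> r) \<cdot>\<^bsub>B\<^esub> (s \<cdot>\<^bsub>B\<^esub> x) = a \<cdot>\<^bsub>B\<^esub> x" if "x \<in> Hom B W P" for x W
    using T.B.Cmp_assoc'[OF T.B.Cmp_Hom[OF that s] r aH] rsx[OF that] by simp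
  have sax: "(s \<cdot>\<^bsub>B\<^esub> a) \<cdot>\<^bsub>B\<^esub> x = s \<cdot>\<^bsub>B\<^esub> (a \<cdot>\<^bsub>B\<^esub> x)" if "x \<in> Hom B W P" for x W
    by (rule T.B.Cmp_assoc'[OF that aH s])
  have sarx: "(s \<cdot>\<^bsub>B\<^esub> (a \<cdot>\<^bsub>B\<^esub> r)) \<cdot>\<^bsub>B\<^esub> (s \<cdot>\<^bsub>B\<^esub> x) = s \<cdot>\<^bsub>B\<^esub> (a \<cdot>\<^bsub>B\<^esub> x)"
    if "x \<in> Hom B W P" for x W
    using T.B.Cmp_assoc'[OF T.B.Cmp_Hom[OF that s] ar s] arx[OF that] by simp
  obtain e where e: "e \<in> Hom A X X" and Te: "far T e = s \<cdot>\<^bsub>B\<^esub> (a \<cdot>\<^bsub>B\<^esub> r)"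
    using ff_from_surj[OF ff X sar] by metis
  have "e \<cdot>\<^bsub>A\<^esub> e = e"
    by (rule ff_from_inj[OF T.A.category_axioms ff T.A.Cmp_Hom[OF e e] e])
      (simp add: T.far_Cmp[OF e e] Te sarx[OF ar] aax[OF r])
  then have "(X, e) \<in> idem_objs A" using e by (simp add: idem_objs_def)
  moreover have "s \<cdot>\<^bsub>B\<^esub> a \<in> idem_hom B (P, a) (fob T X, far T e)"
    by (simp add: idem_hom_def Te sa sarx[OF aH] sax[OF aH] aa)
  moreover have "a \<cdot>\<^bsub>B\<^esub> r \<in> idem_hom B (fob T X, far T e) (P, a)"
    by (simp add: idem_hom_def Te ar arx[OF ar] aax[OF r])
  moreover have "(a \<cdot>\<^bsub>B\<^esub> r) \<cdot>\<^bsub>B\<^esub> (s \<cdot>\<^bsub>B\<^esub> a) = a"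
    by (simp add: arx[OF aH] aa)
  moreover have "(s \<cdot>\<^bsub>B\<^esub> a) \<cdot>\<^bsub>B\<^esub> (a \<cdot>\<^bsub>B\<^esub> r) = far T e"
    by (simp add: Te sax[OF ar] aax[OF r])
  ultimately show ?thesis by blast
qed

text \<open>Completing \<open>opc C\<close> and reversing the completion of \<open>C\<close> give
  triples of opposite orientation, but the same objects and underlying arrows.
  \<open>split_retract\<close> and \<open>ff_from_idem_bij\<close> mention only the latter, so they
  dualize directly.\<close>

lemma idem_opc [simp]:
  "idem_objs (opc C) = idem_objs C" "idem_hom (opc C) x y = idem_hom C y x"
  by (auto simp: idem_objs_def idem_hom_def split: prod.splits)

text \<open>In the completions the retract \<open>P\<close> of \<open>fob T X\<close> turns into an
  isomorphism by \<open>split_retract\<close>, and \<open>ff_from\<close> at \<open>X\<close> passes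
  to \<open>(X, e)\<close>; these are the hypotheses of \<open>coreflectionI\<close>.\<close>

lemma coreflection_up_to_retractsI:
  assumes T: "cat_functor A B T"
    and ex: "\<And>P. P \<in> Ob B \<Longrightarrow> \<exists>X s r. ff_from A B T X \<and>
      s \<in> Hom B P (fob T X) \<and> r \<in> Hom B (fob T X) P \<and> r \<cdot>\<^bsub>B\<^esub> s = Ide B P"
  shows "coreflection_up_to_retracts A B T"
  unfolding coreflection_up_to_retracts_def
proof (rule coreflectionI[OF cat_functor_idem_compl[OF T]])
  interpret T: cat_functor A B T by fact
  have A: "category A" and B: "category B" by unfold_locales
  note eqs = idem_compl_eq[OF A] idem_compl_eq[OF B]
  fix Pa assume Pa: "Pa \<in> Ob (idem_compl B)"
  obtain P a where [simp]: "Pa = (P, a)" by (cases Pa)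
  have a: "(P, a) \<in> idem_objs B" using Pa by (simp add: eqs)
  then have "P \<in> Ob B" using T.B.Hom_Ob by (auto simp: idem_objs_def)
  from ex[OF this] obtain X s r where ff: "ff_from A B T X"
    and sr: "s \<in> Hom B P (fob T X)" "r \<in> Hom B (fob T X) P" "r \<cdot>\<^bsub>B\<^esub> s = Ide B P" by blast
  obtain e u v where e: "(X, e) \<in> idem_objs A"
    and uv: "u \<in> idem_hom B (P, a) (fob T X, far T e)" "v \<in> idem_hom B (fob T X, far T e) (P, a)"
      "v \<cdot>\<^bsub>B\<^esub> u = a" "u \<cdot>\<^bsub>B\<^esub> v = far T e"
    using split_retract[OF T ff sr a] by blast
  have "ff_from (idem_compl A) (idem_compl B) (idem_compl_functor T) (X, e)"
    using e idem_objs_far[OF T] ff_from_idem_bij[OF T ff e]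
    by (auto simp: ff_from_def eqs intro!: bij_betw_triples[where \<phi> = "far T"])
  then show "\<exists>Xe u v. ff_from (idem_compl A) (idem_compl B) (idem_compl_functor T) Xe \<and>
      u \<in> Hom (idem_compl B) Pa (fob (idem_compl_functor T) Xe) \<and>
      v \<in> Hom (idem_compl B) (fob (idem_compl_functor T) Xe) Pa \<and>
      v \<cdot>\<^bsub>idem_compl B\<^esub> u = Ide (idem_compl B) Pa \<and>
      u \<cdot>\<^bsub>idem_compl B\<^esub> v = Ide (idem_compl B) (fob (idem_compl_functor T) Xe)"
    using a uv idem_objs_far[OF T e]
    by (intro exI[of _ "(X, e)"] exI[of _ "((P, a), u, (fob T X, far T e))"]
        exI[of _ "((fob T X, far T e), v, (P, a))"]) (simp add: eqs)
qed

text \<open>The dual argument is carried out on underlying arrows, because the orientation of the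
  triples keeps \<open>idem_compl (opc A)\<close> from being literally
  \<open>opc (idem_compl A)\<close>.\<close>

lemma reflection_up_to_retractsI:
  assumes T: "cat_functor A B T"
    and ex: "\<And>P. P \<in> Ob B \<Longrightarrow> \<exists>X s r. ff_from (opc A) (opc B) T X \<and>
      s \<in> Hom B (fob T X) P \<and> r \<in> Hom B P (fob T X) \<and> s \<cdot>\<^bsub>B\<^esub> r = Ide B P"
  shows "reflection_up_to_retracts A B T"
  unfolding reflection_up_to_retracts_def
proof (rule reflectionI[OF cat_functor_idem_compl[OF T]])
  interpret T: cat_functor A B T by fact
  have A: "category A" and B: "category B" by unfold_locales
  note eqs = idem_compl_eq[OF A] idem_compl_eq[OF B]
  note T' = cat_functor_opc[OF T]
  fix Pa assume Pa: "Pa \<in> Ob (idem_compl B)"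
  obtain P a where [simp]: "Pa = (P, a)" by (cases Pa)
  have a: "(P, a) \<in> idem_objs B" using Pa by (simp add: eqs)
  then have "P \<in> Ob B" using T.B.Hom_Ob by (auto simp: idem_objs_def)
  from ex[OF this] obtain X s r where ff: "ff_from (opc A) (opc B) T X"
    and sr: "s \<in> Hom B (fob T X) P" "r \<in> Hom B P (fob T X)" "s \<cdot>\<^bsub>B\<^esub> r = Ide B P" by blast
  obtain e u v where e: "(X, e) \<in> idem_objs A"
    and uv: "u \<in> idem_hom B (fob T X, far T e) (P, a)" "v \<in> idem_hom B (P, a) (fob T X, far T e)"
      "u \<cdot>\<^bsub>B\<^esub> v = a" "v \<cdot>\<^bsub>B\<^esub> u = far T e"
    \<comment> \<open>In \<open>opc B\<close> the arrow \<open>s\<close> is the section and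
      \<open>r\<close> the retraction.\<close>
    using split_retract[OF T' ff, of s P r a] sr a by auto
  have "ff_from (opc (idem_compl A)) (opc (idem_compl B)) (idem_compl_functor T) (X, e)"
    using e idem_objs_far[OF T] ff_from_idem_bij[OF T' ff, of e]
    by (auto simp: ff_from_def eqs intro!: bij_betw_triples[where \<phi> = "far T"])
  then show "\<exists>Xe u v. ff_from (opc (idem_compl A)) (opc (idem_compl B)) (idem_compl_functor T) Xe \<and>
      u \<in> Hom (idem_compl B) (fob (idem_compl_functor T) Xe) Pa \<and>
      v \<in> Hom (idem_compl B) Pa (fob (idem_compl_functor T) Xe) \<and>
      u \<cdot>\<^bsub>idem_compl B\<^esub> v = Ide (idem_compl B) Pa \<and>
      v \<cdot>\<^bsub>idem_compl B\<^esub> u = Ide (idem_compl B) (fob (idem_compl_functor T) Xe)"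
    using a uv idem_objs_far[OF T e]
    by (intro exI[of _ "(X, e)"] exI[of _ "((fob T X, far T e), u, (P, a))"]
        exI[of _ "((P, a), v, (fob T X, far T e))"]) (simp add: eqs)
qed

section \<open>Modules and comodules\<close>

definition mod_objs ::
  "('o, 'm) cat \<Rightarrow> ('o, 'm, 'o, 'm) funct \<Rightarrow> ('o \<Rightarrow> 'm) \<Rightarrow> ('o \<Rightarrow> 'm) \<Rightarrow> ('o \<times> 'm) set" where
  "mod_objs C T \<mu> \<eta> = {(X, h). X \<in> Ob C \<and> h \<in> Hom C (fob T X) X \<and>
     h \<cdot>\<^bsub>C\<^esub> \<mu> X = h \<cdot>\<^bsub>C\<^esub> far T h \<and> h \<cdot>\<^bsub>C\<^esub> \<eta> X = Ide C X}"

definition mod_hom ::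
  "('o, 'm) cat \<Rightarrow> ('o, 'm, 'o, 'm) funct \<Rightarrow> 'o \<times> 'm \<Rightarrow> 'o \<times> 'm \<Rightarrow> 'm set" where
  "mod_hom C T = (\<lambda>(X, h) (X', h'). {f \<in> Hom C X X'. f \<cdot>\<^bsub>C\<^esub> h = h' \<cdot>\<^bsub>C\<^esub> far T f})"

lemma em_modules_eq:
  "em_modules C T \<mu> \<eta> = tri_cat C (mod_objs C T \<mu> \<eta>) (Ide C \<circ> fst) (mod_hom C T)"
  unfolding em_modules_def tri_cat_def mod_objs_def[symmetric] Let_def
  by (auto simp: mod_hom_def fun_eq_iff)

text \<open>
  The objects are exactly those of the modules over the opposite category, but the triples of the
  arrows are reversed, so this is not literally an opposite category of modules.
\<close>

lemma em_comodules_eq: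
  "em_comodules D W \<Delta> \<epsilon> =
     tri_cat D (mod_objs (opc D) W \<Delta> \<epsilon>) (Ide D \<circ> fst) (\<lambda>x y. mod_hom (opc D) W y x)"
proof -
  have "{(Y, r). Y \<in> Ob D \<and> r \<in> Hom D Y (fob W Y) \<and>
      \<Delta> Y \<cdot>\<^bsub>D\<^esub> r = far W r \<cdot>\<^bsub>D\<^esub> r \<and> \<epsilon> Y \<cdot>\<^bsub>D\<^esub> r = Ide D Y} = mod_objs (opc D) W \<Delta> \<epsilon>"
    by (simp add: mod_objs_def)
  then show ?thesis
    unfolding em_comodules_def tri_cat_def Let_def
    by (auto simp: mod_hom_def fun_eq_iff)
qed

lemma mod_hom_Ide:
  assumes T: "cat_functor C C T" and "x \<in> mod_objs C T \<mu> \<eta>"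
  shows "(Ide C \<circ> fst) x \<in> mod_hom C T x x"
proof -
  interpret T: cat_functor C C T by fact
  show ?thesis
    using assms(2) by (auto simp: mod_objs_def mod_hom_def T.A.Ide_Hom T.far_Ide T.A.Cmp_Ide T.A.Ide_Cmp)
qed

lemma mod_hom_Cmp:
  assumes T: "cat_functor C C T"
    and "x \<in> mod_objs C T \<mu> \<eta>" "y \<in> mod_objs C T \<mu> \<eta>" "z \<in> mod_objs C T \<mu> \<eta>"
    and "f \<in> mod_hom C T x y" "g \<in> mod_hom C T y z"
  shows "g \<cdot>\<^bsub>C\<^esub> f \<in> mod_hom C T x z"
proof -
  interpret T: cat_functor C C T by fact
  obtain X h Y k Z l where xyz: "x = (X, h)" "y = (Y, k)" "z = (Z, l)"
    by (metis surj_pair)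
  have h: "h \<in> Hom C (fob T X) X" "k \<in> Hom C (fob T Y) Y" "l \<in> Hom C (fob T Z) Z"
    using assms(2-4) by (auto simp: xyz mod_objs_def)
  have f: "f \<in> Hom C X Y" "f \<cdot>\<^bsub>C\<^esub> h = k \<cdot>\<^bsub>C\<^esub> far T f"
    and g: "g \<in> Hom C Y Z" "g \<cdot>\<^bsub>C\<^esub> k = l \<cdot>\<^bsub>C\<^esub> far T g"
    using assms(5,6) by (auto simp: xyz mod_hom_def)
  have "(g \<cdot>\<^bsub>C\<^esub> f) \<cdot>\<^bsub>C\<^esub> h = l \<cdot>\<^bsub>C\<^esub> far T (g \<cdot>\<^bsub>C\<^esub> f)"
    using T.A.Cmp_assoc'[OF h(1) f(1) g(1)] T.A.Cmp_reduce[OF g(2) h(2) g(1) T.far_Hom[OF f(1)]]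
      T.A.Cmp_assoc'[OF T.far_Hom[OF f(1)] T.far_Hom[OF g(1)] h(3)]
    by (simp add: f(2) T.far_Cmp[OF f(1) g(1)])
  then show ?thesis
    by (simp add: xyz mod_hom_def T.A.Cmp_Hom[OF f(1) g(1)])
qed

lemma category_em_modules:
  assumes T: "cat_functor C C T"
  shows "category (em_modules C T \<mu> \<eta>)"
proof -
  interpret T: cat_functor C C T by fact
  show ?thesis
    unfolding em_modules_eq
    by (rule category_tri_cat[where k = fst, OF T.A.category_axioms _ mod_hom_Cmp[OF T] mod_hom_Ide[OF T]])
      (auto simp: mod_hom_def T.A.Cmp_Ide T.A.Ide_Cmp)
qed

lemma category_em_comodules:
  assumes W: "cat_functor D D W"
  shows "category (em_comodules D W \<Delta> \<epsilon>)"
proof -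
  interpret W: cat_functor D D W by fact
  note W' = cat_functor_opc[OF W]
  show ?thesis
    unfolding em_comodules_eq
  proof (rule category_tri_cat[where k = fst, OF W.A.category_axioms])
    fix x y z f g
    assume "x \<in> mod_objs (opc D) W \<Delta> \<epsilon>" "y \<in> mod_objs (opc D) W \<Delta> \<epsilon>"
      "z \<in> mod_objs (opc D) W \<Delta> \<epsilon>" "f \<in> mod_hom (opc D) W y x" "g \<in> mod_hom (opc D) W z y"
    then show "g \<cdot>\<^bsub>D\<^esub> f \<in> mod_hom (opc D) W z x"
      using mod_hom_Cmp[OF W', of z \<Delta> \<epsilon> y x g f] by simp
  next
    fix x assume "x \<in> mod_objs (opc D) W \<Delta> \<epsilon>"
    then show "(Ide D \<circ> fst) x \<in> mod_hom (opc D) W x x"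
      using mod_hom_Ide[OF W'] by simp
  qed (auto simp: mod_hom_def W.A.Cmp_Ide W.A.Ide_Cmp)
qed

text \<open>The action law \<open>h \<mu> = h T(h)\<close> and \<open>\<mu> \<sigma> = Id\<close>
  show that \<open>s = T(h) \<sigma> \<eta>\<close> is a section of \<open>h\<close>. It is linear
  because \<open>s h\<close> and \<open>\<mu> T(s)\<close> both equal \<open>T(h) \<sigma>\<close>,
  one by each half of the separability condition.\<close>

lemma separable_module_retract:
  assumes sep: "separable_monad C T \<mu> \<eta>" and x: "(X, h) \<in> mod_objs C T \<mu> \<eta>"
  shows "\<exists>s \<in> mod_hom C T (X, h) (fob T X, \<mu> X). h \<cdot>\<^bsub>C\<^esub> s = Ide C X"
proof -
  interpret monad C T \<mu> \<eta> using sep by (simp add: separable_monad_def)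
  obtain \<sigma> where "nat_trans C C T (T \<circ>\<^sub>F T) \<sigma>"
    and sigma: "\<And>X. X \<in> Ob C \<Longrightarrow> \<mu> X \<cdot>\<^bsub>C\<^esub> \<sigma> X = Ide C (fob T X)"
      "\<And>X. X \<in> Ob C \<Longrightarrow> far T (\<mu> X) \<cdot>\<^bsub>C\<^esub> \<sigma> (fob T X) = \<sigma> X \<cdot>\<^bsub>C\<^esub> \<mu> X"
      "\<And>X. X \<in> Ob C \<Longrightarrow> \<sigma> X \<cdot>\<^bsub>C\<^esub> \<mu> X = \<mu> (fob T X) \<cdot>\<^bsub>C\<^esub> far T (\<sigma> X)"
    using sep unfolding separable_monad_def by blast
  interpret S: nat_trans C C T "T \<circ>\<^sub>F T" \<sigma> by fact
  note Hom = mult.T.far_Hom and Cmp = mult.T.far_Cmp and Ob = mult.T.fob_Ob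
  have C: "category C" by unfold_locales
  note comp = category.Cmp_Hom[OF C] and assoc = category.Cmp_assoc'[OF C]
    and red = category.Cmp_reduce[OF C]
    and Cmp_Ide = category.Cmp_Ide[OF C] and Ide_Cmp = category.Ide_Cmp[OF C]
  have X: "X \<in> Ob C" and h: "h \<in> Hom C (fob T X) X"
    and hm: "h \<cdot>\<^bsub>C\<^esub> \<mu> X = h \<cdot>\<^bsub>C\<^esub> far T h" and he: "h \<cdot>\<^bsub>C\<^esub> \<eta> X = Ide C X"
    using x by (auto simp: mod_objs_def)
  let ?T = "fob T" and ?t = "far T"
  have mH: "\<mu> Z \<in> Hom C (?T (?T Z)) (?T Z)" if "Z \<in> Ob C" for Z
    using mult.component[OF that] by (simp add: fcomp_def)
  have eH: "\<eta> Z \<in> Hom C Z (?T Z)" if "Z \<in> Ob C" for Z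
    using unit.component[OF that] by (simp add: idfun_def)
  have sH: "\<sigma> Z \<in> Hom C (?T Z) (?T (?T Z))" if "Z \<in> Ob C" for Z
    using S.component[OF that] by (simp add: fcomp_def)
  have mN: "\<mu> Z' \<cdot>\<^bsub>C\<^esub> ?t (?t f) = ?t f \<cdot>\<^bsub>C\<^esub> \<mu> Z" if "f \<in> Hom C Z Z'" for f Z Z'
    using mult.naturality[OF that] by (simp add: fcomp_def)
  have eN: "\<eta> Z' \<cdot>\<^bsub>C\<^esub> f = ?t f \<cdot>\<^bsub>C\<^esub> \<eta> Z" if "f \<in> Hom C Z Z'" for f Z Z'
    using unit.naturality[OF that] by (simp add: idfun_def)
  have sN: "\<sigma> Z' \<cdot>\<^bsub>C\<^esub> ?t f = ?t (?t f) \<cdot>\<^bsub>C\<^esub> \<sigma> Z" if "f \<in> Hom C Z Z'" for f Z Z'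
    using S.naturality[OF that] by (simp add: fcomp_def)
  note TX = Ob[OF X]
  note mX = mH[OF X] and eX = eH[OF X] and sX = sH[OF X]
  note mTX = mH[OF TX] and eTX = eH[OF TX] and sTX = sH[OF TX]
  note th = Hom[OF h]
  define s where "s = ?t h \<cdot>\<^bsub>C\<^esub> (\<sigma> X \<cdot>\<^bsub>C\<^esub> \<eta> X)"
  have se: "\<sigma> X \<cdot>\<^bsub>C\<^esub> \<eta> X \<in> Hom C X (?T (?T X))" by (rule comp[OF eX sX])
  have s: "s \<in> Hom C X (?T X)" unfolding s_def by (rule comp[OF se th])
  have "h \<cdot>\<^bsub>C\<^esub> s = (h \<cdot>\<^bsub>C\<^esub> \<mu> X) \<cdot>\<^bsub>C\<^esub> (\<sigma> X \<cdot>\<^bsub>C\<^esub> \<eta> X)"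
    unfolding s_def hm by (rule red[OF refl th h se])
  also have "\<dots> = Ide C X"
    using assoc[OF se mX h] red[OF sigma(1)[OF X] sX mX eX] Ide_Cmp[OF eX] he by simp
  finally have hs: "h \<cdot>\<^bsub>C\<^esub> s = Ide C X" .
  \<comment> \<open>Naturality of \<eta> and \<sigma> moves \<open>h\<close> to the left as
    \<open>T(T(h))\<close>, which the action law replaces by \<open>T(\<mu>)\<close> behind
    \<open>T(h)\<close>. Then \<open>T(\<mu>) \<sigma>\<close> becomes
    \<open>\<sigma> \<mu>\<close>, and the left unit law removes \<eta>.\<close>
  have "s \<cdot>\<^bsub>C\<^esub> h = ?t h \<cdot>\<^bsub>C\<^esub> (\<sigma> X \<cdot>\<^bsub>C\<^esub> (\<eta> X \<cdot>\<^bsub>C\<^esub> h))"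
    unfolding s_def using assoc[OF h se th] assoc[OF h eX sX] by simp
  also have "\<dots> = ?t h \<cdot>\<^bsub>C\<^esub> (?t (?t h) \<cdot>\<^bsub>C\<^esub> (\<sigma> (?T X) \<cdot>\<^bsub>C\<^esub> \<eta> (?T X)))"
    using red[OF sN[OF h] th sX eTX] assoc[OF eTX sTX Hom[OF th]] eN[OF h] by simp
  also have "\<dots> = (?t h \<cdot>\<^bsub>C\<^esub> ?t (\<mu> X)) \<cdot>\<^bsub>C\<^esub> (\<sigma> (?T X) \<cdot>\<^bsub>C\<^esub> \<eta> (?T X))"
    using red[OF refl Hom[OF th] th comp[OF eTX sTX]] Cmp[OF th h] Cmp[OF mX h] hm by simp
  also have "\<dots> = ?t h \<cdot>\<^bsub>C\<^esub> ((\<sigma> X \<cdot>\<^bsub>C\<^esub> \<mu> X) \<cdot>\<^bsub>C\<^esub> \<eta> (?T X))"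
    using assoc[OF comp[OF eTX sTX] Hom[OF mX] th] red[OF sigma(2)[OF X] sTX Hom[OF mX] eTX] by simp
  also have "\<dots> = ?t h \<cdot>\<^bsub>C\<^esub> \<sigma> X"
    using assoc[OF eTX mX sX] mult_unit_left[OF X] Cmp_Ide[OF sX] by simp
  finally have sh: "s \<cdot>\<^bsub>C\<^esub> h = ?t h \<cdot>\<^bsub>C\<^esub> \<sigma> X" .
  have ts: "?t s = ?t (?t h) \<cdot>\<^bsub>C\<^esub> (?t (\<sigma> X) \<cdot>\<^bsub>C\<^esub> ?t (\<eta> X))"
    unfolding s_def by (simp add: Cmp[OF se th] Cmp[OF eX sX])
  \<comment> \<open>Here naturality of \<mu> brings \<open>T(h)\<close> to the front; the other half
    of separability and the right unit law finish.\<close>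
  have "\<mu> X \<cdot>\<^bsub>C\<^esub> ?t s = ?t h \<cdot>\<^bsub>C\<^esub> (\<mu> (?T X) \<cdot>\<^bsub>C\<^esub> (?t (\<sigma> X) \<cdot>\<^bsub>C\<^esub> ?t (\<eta> X)))"
    unfolding ts using comp[OF Hom[OF eX] Hom[OF sX]]
      red[OF mN[OF h] Hom[OF th] mX] assoc[OF _ mTX th] by simp
  also have "\<dots> = ?t h \<cdot>\<^bsub>C\<^esub> ((\<sigma> X \<cdot>\<^bsub>C\<^esub> \<mu> X) \<cdot>\<^bsub>C\<^esub> ?t (\<eta> X))"
    using red[OF sigma(3)[OF X, symmetric] Hom[OF sX] mTX Hom[OF eX]] by simp
  also have "\<dots> = ?t h \<cdot>\<^bsub>C\<^esub> \<sigma> X"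
    using assoc[OF Hom[OF eX] mX sX] mult_unit_right[OF X] Cmp_Ide[OF sX] by simp
  finally have "s \<in> mod_hom C T (X, h) (?T X, \<mu> X)"
    using s sh by (simp add: mod_hom_def)
  with hs show ?thesis by blast
qed

section \<open>The comparison functor of an adjunction on underlying arrows\<close>

context adjunction
begin

lemma GF_functor: "cat_functor C C (G \<circ>\<^sub>F F)"
  by (rule cat_functor_fcomp[OF F.cat_functor_axioms G.cat_functor_axioms])

text \<open>Image under \<open>G\<close> of the naturality of the counit. It makes
  \<open>far G f\<close> a module map, and at \<open>f = \<epsilon> Y\<close> it is the
  associativity of the action on \<open>fob G Y\<close>.\<close>

lemma G_counit_nat:
  assumes f: "f \<in> Hom D X Y"
  shows "far G f \<cdot>\<^bsub>C\<^esub> far G (\<epsilon> X) = far G (\<epsilon> Y) \<cdot>\<^bsub>C\<^esub> far G (far F (far G f))"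
proof -
  have o: "X \<in> Ob D" "Y \<in> Ob D" using D.Hom_Ob[OF f] by auto
  show ?thesis
    using G.far_Cmp[OF F.far_Hom[OF G.far_Hom[OF f]] counit_Hom[OF o(2)]]
      G.far_Cmp[OF counit_Hom[OF o(1)] f] counit_nat[OF f] by simp
qed

lemma comparison_mod_objs:
  assumes Y: "Y \<in> Ob D"
  shows "(fob G Y, far G (\<epsilon> Y)) \<in> mod_objs C (G \<circ>\<^sub>F F) (\<lambda>X. far G (\<epsilon> (fob F X))) \<eta>"
  using G_counit_nat[OF counit_Hom[OF Y]] triangle_G[OF Y] G.fob_Ob[OF Y]
    G.far_Hom[OF counit_Hom[OF Y]]
  by (simp add: mod_objs_def fcomp_def)

lemma comparison_mod_hom:
  assumes f: "f \<in> Hom D X Y"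
  shows "far G f \<in> mod_hom C (G \<circ>\<^sub>F F) (fob G X, far G (\<epsilon> X)) (fob G Y, far G (\<epsilon> Y))"
  using G_counit_nat[OF f] G.far_Hom[OF f] by (simp add: mod_hom_def fcomp_def)

text \<open>Module maps out of the free module on \<open>X\<close> are determined by their composite
  with \<open>\<eta> X\<close>, and the adjunction turns such composites into arrows out of
  \<open>fob F X\<close>. The inverse of \<open>far G\<close> sends \<open>g\<close> to
  \<open>\<epsilon> Y\<close> after \<open>F(g \<eta>)\<close>.\<close>

lemma bij_betw_comparison:
  assumes X: "X \<in> Ob C" and Y: "Y \<in> Ob D"
  shows "bij_betw (far G) (Hom D (fob F X) Y)
    (mod_hom C (G \<circ>\<^sub>F F) (fob G (fob F X), far G (\<epsilon> (fob F X))) (fob G Y, far G (\<epsilon> Y)))"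
proof (rule bij_betw_imageI)
  note FX = F.fob_Ob[OF X]
  note uX = unit_Hom[OF X] and cY = counit_Hom[OF Y] and cFX = counit_Hom[OF FX]
  have transpose: "\<epsilon> Y \<cdot>\<^bsub>D\<^esub> far F (far G f \<cdot>\<^bsub>C\<^esub> \<eta> X) = f" if f: "f \<in> Hom D (fob F X) Y" for f
  proof -
    note Gf = G.far_Hom[OF f]
    show ?thesis
      using D.Cmp_reduce[OF counit_nat[OF f] F.far_Hom[OF Gf] cY F.far_Hom[OF uX]]
        D.Cmp_assoc'[OF F.far_Hom[OF uX] cFX f] triangle_F[OF X] D.Cmp_Ide[OF f]
      by (simp add: F.far_Cmp[OF uX Gf])
  qed
  show "inj_on (far G) (Hom D (fob F X) Y)"
    by (rule inj_onI) (metis transpose)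
  show "far G ` Hom D (fob F X) Y =
    mod_hom C (G \<circ>\<^sub>F F) (fob G (fob F X), far G (\<epsilon> (fob F X))) (fob G Y, far G (\<epsilon> Y))"
  proof (intro subset_antisym subsetI)
    fix g assume "g \<in> mod_hom C (G \<circ>\<^sub>F F)
      (fob G (fob F X), far G (\<epsilon> (fob F X))) (fob G Y, far G (\<epsilon> Y))"
    then have g: "g \<in> Hom C (fob G (fob F X)) (fob G Y)"
      and gm: "g \<cdot>\<^bsub>C\<^esub> far G (\<epsilon> (fob F X)) = far G (\<epsilon> Y) \<cdot>\<^bsub>C\<^esub> far G (far F g)"
      by (auto simp: mod_hom_def fcomp_def)
    have gu: "g \<cdot>\<^bsub>C\<^esub> \<eta> X \<in> Hom C X (fob G Y)" by (rule C.Cmp_Hom[OF uX g])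
    note GFu = G.far_Hom[OF F.far_Hom[OF uX]] and GFg = G.far_Hom[OF F.far_Hom[OF g]]
    have "far G (\<epsilon> Y \<cdot>\<^bsub>D\<^esub> far F (g \<cdot>\<^bsub>C\<^esub> \<eta> X)) =
        far G (\<epsilon> Y) \<cdot>\<^bsub>C\<^esub> (far G (far F g) \<cdot>\<^bsub>C\<^esub> far G (far F (\<eta> X)))"
      by (simp add: F.far_Cmp[OF uX g]
          G.far_Cmp[OF D.Cmp_Hom[OF F.far_Hom[OF uX] F.far_Hom[OF g]] cY]
          G.far_Cmp[OF F.far_Hom[OF uX] F.far_Hom[OF g]])
    \<comment> \<open>Linearity of \<open>g\<close> exchanges the action on \<open>fob G Y\<close>
      for the free action; what remains behind \<open>g\<close> is the image under \<open>G\<close>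
      of a triangle identity.\<close>
    also have "\<dots> = g \<cdot>\<^bsub>C\<^esub> (far G (\<epsilon> (fob F X)) \<cdot>\<^bsub>C\<^esub> far G (far F (\<eta> X)))"
      using C.Cmp_reduce[OF gm[symmetric] GFg G.far_Hom[OF cY] GFu]
        C.Cmp_assoc'[OF GFu G.far_Hom[OF cFX] g] by simp
    also have "\<dots> = g"
      using G.far_Cmp[OF F.far_Hom[OF uX] cFX] triangle_F[OF X] G.far_Ide[OF FX] C.Cmp_Ide[OF g]
      by simp
    finally show "g \<in> far G ` Hom D (fob F X) Y"
      using D.Cmp_Hom[OF F.far_Hom[OF gu] cY] by (metis imageI)
  qed (auto intro: comparison_mod_hom)
qed

end

section \<open>Comparison and cocomparison up to retracts\<close>

lemma comparison_functor_simps: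
  "fob (comparison_functor D G \<epsilon>) Y = (fob G Y, far G (\<epsilon> Y))"
  "f \<in> Hom D X Y \<Longrightarrow> far (comparison_functor D G \<epsilon>) f =
     ((fob G X, far G (\<epsilon> X)), far G f, (fob G Y, far G (\<epsilon> Y)))"
  by (auto simp: comparison_functor_def Let_def Hom_def)

lemma cocomparison_functor_simps:
  "fob (cocomparison_functor C F \<eta>) X = (fob F X, far F (\<eta> X))"
  "f \<in> Hom C X Y \<Longrightarrow> far (cocomparison_functor C F \<eta>) f =
     ((fob F X, far F (\<eta> X)), far F f, (fob F Y, far F (\<eta> Y)))"
  by (auto simp: cocomparison_functor_def Let_def Hom_def)

lemma comparison_coreflection:
  assumes adj: "adjunction C D F G \<eta> \<epsilon>"
    and sep: "separable_monad C (G \<circ>\<^sub>F F) (\<lambda>X. far G (\<epsilon> (fob F X))) \<eta>"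
  shows "coreflection_up_to_retracts D (em_modules C (G \<circ>\<^sub>F F) (\<lambda>X. far G (\<epsilon> (fob F X))) \<eta>)
    (comparison_functor D G \<epsilon>)"
proof -
  interpret adjunction C D F G \<eta> \<epsilon> by fact
  let ?\<mu> = "\<lambda>X. far G (\<epsilon> (fob F X))"
  let ?E = "em_modules C (G \<circ>\<^sub>F F) ?\<mu> \<eta>" and ?K = "comparison_functor D G \<epsilon>"
  note K = comparison_functor_simps and objs = comparison_mod_objs
  show ?thesis
  proof (rule coreflection_up_to_retractsI)
    show "cat_functor D ?E ?K"
    proof (rule cat_functor.intro[OF D.category_axioms category_em_modules[OF GF_functor]
          cat_functor_axioms.intro])
      fix f X Y assume f: "f \<in> Hom D X Y"
      show "far ?K f \<in> Hom ?E (fob ?K X) (fob ?K Y)"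
        using D.Hom_Ob[OF f] by (simp add: K(1) K(2)[OF f] em_modules_eq objs comparison_mod_hom[OF f])
      fix g Z assume g: "g \<in> Hom D Y Z"
      show "far ?K (g \<cdot>\<^bsub>D\<^esub> f) = far ?K g \<cdot>\<^bsub>?E\<^esub> far ?K f"
        by (simp add: K(2)[OF f] K(2)[OF g] K(2)[OF D.Cmp_Hom[OF f g]] em_modules_eq G.far_Cmp[OF f g])
    next
      fix X assume X: "X \<in> Ob D"
      show "fob ?K X \<in> Ob ?E" by (simp add: K(1) em_modules_eq objs[OF X])
      show "far ?K (Ide D X) = Ide ?E (fob ?K X)"
        by (simp add: K(1) K(2)[OF D.Ide_Hom[OF X]] em_modules_eq G.far_Ide[OF X])
    qed
  next
    fix P assume P: "P \<in> Ob ?E"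
    obtain X h where [simp]: "P = (X, h)" by (cases P)
    have x: "(X, h) \<in> mod_objs C (G \<circ>\<^sub>F F) ?\<mu> \<eta>" using P by (simp add: em_modules_eq)
    then have X: "X \<in> Ob C" by (simp add: mod_objs_def)
    note FX = F.fob_Ob[OF X]
    \<comment> \<open>The action law of \<open>(X, h)\<close> says exactly that \<open>h\<close> is
      a module map from the free module, which is the image of \<open>fob F X\<close>.\<close>
    have hH: "h \<in> mod_hom C (G \<circ>\<^sub>F F) (fob ?K (fob F X)) (X, h)"
      using x by (simp add: mod_objs_def mod_hom_def K(1) fcomp_def)
    obtain s where s: "s \<in> mod_hom C (G \<circ>\<^sub>F F) (X, h) (fob ?K (fob F X))" "h \<cdot>\<^bsub>C\<^esub> s = Ide C X"
      using separable_module_retract[OF sep x] by (auto simp: K(1) fcomp_def)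
    have "ff_from D ?E ?K (fob F X)"
      using FX objs bij_betw_comparison[OF X]
      by (auto simp: ff_from_def em_modules_eq K(1) intro!: bij_betw_into_triples[where \<phi> = "far G"] K(2))
    then show "\<exists>Y s r. ff_from D ?E ?K Y \<and> s \<in> Hom ?E P (fob ?K Y) \<and>
        r \<in> Hom ?E (fob ?K Y) P \<and> r \<cdot>\<^bsub>?E\<^esub> s = Ide ?E P"
      using s hH x objs[OF FX]
      by (intro exI[of _ "fob F X"] exI[of _ "(P, s, fob ?K (fob F X))"]
          exI[of _ "(fob ?K (fob F X), h, P)"]) (simp add: em_modules_eq K(1))
  qed
qed

text \<open>Over the opposite categories \<open>G\<close> is left adjoint to \<open>F\<close>, and
  the comonad becomes a monad on \<open>opc D\<close>. The facts about modules then show that every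
  comodule is a retract of the cofree one on \<open>fob G Y\<close>, with the coaction
  \<open>h\<close> as section.\<close>

lemma cocomparison_reflection:
  assumes adj: "adjunction C D F G \<eta> \<epsilon>"
    and cosep: "coseparable_comonad D (F \<circ>\<^sub>F G) (\<lambda>Y. far F (\<eta> (fob G Y))) \<epsilon>"
  shows "reflection_up_to_retracts C (em_comodules D (F \<circ>\<^sub>F G) (\<lambda>Y. far F (\<eta> (fob G Y))) \<epsilon>)
    (cocomparison_functor C F \<eta>)"
proof -
  interpret adjunction C D F G \<eta> \<epsilon> by fact
  interpret op: adjunction "opc D" "opc C" G F \<epsilon> \<eta> by (rule adjunction_opc[OF adj])
  let ?\<Delta> = "\<lambda>Y. far F (\<eta> (fob G Y))"
  let ?E = "em_comodules D (F \<circ>\<^sub>F G) ?\<Delta> \<epsilon>" and ?K = "cocomparison_functor C F \<eta>"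
  note K = cocomparison_functor_simps
  have objs: "(fob F X, far F (\<eta> X)) \<in> mod_objs (opc D) (F \<circ>\<^sub>F G) ?\<Delta> \<epsilon>" if "X \<in> Ob C" for X
    using op.comparison_mod_objs that by simp
  have hom: "far F f \<in> mod_hom (opc D) (F \<circ>\<^sub>F G) (fob F Y, far F (\<eta> Y)) (fob F X, far F (\<eta> X))"
    if "f \<in> Hom C X Y" for f X Y
    using op.comparison_mod_hom that by simp
  have FG: "cat_functor D D (F \<circ>\<^sub>F G)"
    by (rule cat_functor_fcomp[OF G.cat_functor_axioms F.cat_functor_axioms])
  show ?thesis
  proof (rule reflection_up_to_retractsI)
    show "cat_functor C ?E ?K"
    proof (rule cat_functor.intro[OF C.category_axioms category_em_comodules[OF FG]
          cat_functor_axioms.intro])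
      fix f X Y assume f: "f \<in> Hom C X Y"
      show "far ?K f \<in> Hom ?E (fob ?K X) (fob ?K Y)"
        using C.Hom_Ob[OF f] by (simp add: K(1) K(2)[OF f] em_comodules_eq objs hom[OF f])
      fix g Z assume g: "g \<in> Hom C Y Z"
      show "far ?K (g \<cdot>\<^bsub>C\<^esub> f) = far ?K g \<cdot>\<^bsub>?E\<^esub> far ?K f"
        by (simp add: K(2)[OF f] K(2)[OF g] K(2)[OF C.Cmp_Hom[OF f g]] em_comodules_eq F.far_Cmp[OF f g])
    next
      fix X assume X: "X \<in> Ob C"
      show "fob ?K X \<in> Ob ?E" by (simp add: K(1) em_comodules_eq objs[OF X])
      show "far ?K (Ide C X) = Ide ?E (fob ?K X)"
        by (simp add: K(1) K(2)[OF C.Ide_Hom[OF X]] em_comodules_eq F.far_Ide[OF X])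
    qed
  next
    fix P assume P: "P \<in> Ob ?E"
    obtain Y h where [simp]: "P = (Y, h)" by (cases P)
    have y: "(Y, h) \<in> mod_objs (opc D) (F \<circ>\<^sub>F G) ?\<Delta> \<epsilon>" using P by (simp add: em_comodules_eq)
    then have Y: "Y \<in> Ob D" by (simp add: mod_objs_def)
    note GY = G.fob_Ob[OF Y]
    have hH: "h \<in> mod_hom (opc D) (F \<circ>\<^sub>F G) (fob ?K (fob G Y)) (Y, h)"
      using y by (simp add: mod_objs_def mod_hom_def K(1) fcomp_def)
    obtain s where s: "s \<in> mod_hom (opc D) (F \<circ>\<^sub>F G) (Y, h) (fob ?K (fob G Y))"
      "s \<cdot>\<^bsub>D\<^esub> h = Ide D Y"
      using separable_module_retract[OF separable_monad_opc[OF cosep] y] by (auto simp: K(1) fcomp_def)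
    have "ff_from (opc C) (opc ?E) ?K (fob G Y)"
      using GY objs op.bij_betw_comparison[of Y] Y
      by (auto simp: ff_from_def em_comodules_eq K(1) intro!: bij_betw_into_triples[where \<phi> = "far F"] K(2))
    then show "\<exists>X s r. ff_from (opc C) (opc ?E) ?K X \<and> s \<in> Hom ?E (fob ?K X) P \<and>
        r \<in> Hom ?E P (fob ?K X) \<and> s \<cdot>\<^bsub>?E\<^esub> r = Ide ?E P"
      using s hH y objs[OF GY]
      by (intro exI[of _ "fob G Y"] exI[of _ "(fob ?K (fob G Y), s, P)"]
          exI[of _ "(P, h, fob ?K (fob G Y))"]) (simp add: em_comodules_eq K(1))
  qed
qed

theorem theorem3p4:
  fixes C :: "('o, 'm) cat" and D :: "('p, 'n) cat"
    and F :: "('o, 'm, 'p, 'n) funct" and G :: "('p, 'n, 'o, 'm) funct"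
    and \<eta> :: "'o \<Rightarrow> 'm" and \<epsilon> :: "'p \<Rightarrow> 'n"
  assumes "adjunction C D F G \<eta> \<epsilon>"
  shows "(separable_monad C (G \<circ>\<^sub>F F) (\<lambda>X. far G (\<epsilon> (fob F X))) \<eta> \<longrightarrow>
           coreflection_up_to_retracts
             D (em_modules C (G \<circ>\<^sub>F F) (\<lambda>X. far G (\<epsilon> (fob F X))) \<eta>)
             (comparison_functor D G \<epsilon>)) \<and>
         (coseparable_comonad D (F \<circ>\<^sub>F G) (\<lambda>Y. far F (\<eta> (fob G Y))) \<epsilon> \<longrightarrow>
           reflection_up_to_retracts
             C (em_comodules D (F \<circ>\<^sub>F G) (\<lambda>Y. far F (\<eta> (fob G Y))) \<epsilon>)
             (cocomparison_functor C F \<eta>))"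
  using comparison_coreflection[OF assms] cocomparison_reflection[OF assms] by blast

end
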